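(* For each $n$ consider the random intersection graph with communities $\mathrm{RIGC}(\boldsymbol d^{l},\mathbf{Com})$, under conditions (A)–(D) of the context. Let $F_n^{p}(x)=\frac1{N_n}\sum_{v\in[N_n]}\mathbf 1_{\{\deg(v)\le x\}}$ be the (random) empirical distribution function of the degrees in $\mathrm{RIGC}(\boldsymbol d^{l},\mathbf{Com})$, let $D_n^{p}$ be the degree in $\mathrm{RIGC}(\boldsymbol d^{l},\mathbf{Com})$ of a uniformly chosen individual, and let $$D^{p}\overset{d}{=}\sum_{i=1}^{D^{l}}D^{c}_{(i)},\qquad F^{p}(x)=\mathbb P(D^{p}\le x),$$ where $(D^{c}_{(i)})_{i\ge1}$ are i.i.d. copies of $D^{c}$, independent of $D^l$. Then, as $n\to\infty$, $$\sup_{x\in\mathbb R}\big|F_n^{p}(x)-F^{p}(x)\big|\xrightarrow{\ \mathbb P\ }0,$$ and consequently $D_n^{p}\to D^{p}$ in distribution.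
   Context: **Model.** For each $n$: individuals $\mathscr V^{l}=[N_n]$ and communities $\mathscr V^{r}=[M_n]$ (treated as disjoint sets), with $N_n,M_n\to\infty$. Each individual $v$ has a number of memberships ($l$-degree) $d^{l}_v\ge 1$. Let $\mathscr H$ be the set of non-empty, simple, finite, connected graphs, one representative per isomorphism class, with $H\in\mathscr H$ having vertex set $[|H|]$. Each community $a$ has a community graph $\mathrm{Com}_a\in\mathscr H$, and $r$-degree $d^{r}_a=|\mathrm{Com}_a|\ge1$. Assume $h_n:=\sum_{v}d^{l}_v=\sum_a d^{r}_a$. Individual $v$ has $l$-half-edges $(v,i)$, $i\in[d^l_v]$; community $a$ has $r$-half-edges $(a,k)$, $k\in[d^r_a]$, the half-edge $(a,k)$ representing the vertex of $\mathrm{Com}_a$ labelled $k$ (a "community role"). Let $\omega_n$ be a uniformly random bijection between $l$-half-edges and $r$-half-edges. If $(v,i)$ is matched to $(a,k)$ we say $v$ takes the role $j=(a,k)$. $\mathrm{RIGC}(\boldsymbol d^l,\mathbf{Com})$ is the random multigraph on $\mathscr V^l$ obtained by adding, for every community $a$ and every edge $\{j_1,j_2\}$ of $\mathrm{Com}_a$, one edge between the individuals taking roles $j_1$ and $j_2$ (self-loops and multiple edges allowed, each community edge copied separately). Degrees count multiplicity, and each self-loop contributes $2$; equivalently $\deg(v)$ is the sum, over all roles $j$ taken by $v$, of the degree of $j$ in its community graph. The uniformly chosen individual is independent of $\omega_n$. **Assumptions.** Let $D_n^l=d^l_{V}$ with $V$ uniform on $[N_n]$, $D_n^r=d^r_{A}$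 with $A$ uniform on $[M_n]$, and $\mu^{(n)}_H=|\{a:\mathrm{Com}_a=H\}|/M_n$ for $H\in\mathscr H$. (A) $D_n^l$ converges in distribution to a random variable $D^l$. (B) $\mathbb E[D_n^l]\to\mathbb E[D^l]<\infty$. (C) There is a probability mass function $\mu$ on $\mathscr H$ with $\mu_H^{(n)}\to\mu_H$ for all $H$; consequently $D_n^r$ converges in distribution to $D^r$ with pmf $q_k=\sum_{|H|=k}\mu_H$. (D) $\mathbb E[D_n^r]\to\mathbb E[D^r]<\infty$. **Community degree.** Let $D_n^c$ be the degree, within its community graph, of a community role chosen uniformly at random among all $h_n$ community roles (the vertices of the disjoint union of all $\mathrm{Com}_a$). Under the assumptions $D_n^c$ converges in distribution; $D^c$ denotes a random variable with the limiting law. *)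

theory Defs
  imports "HOL-Probability.Probability" "HOL-Library.Multiset"
begin

section \<open>Simple graphs and community graphs\<close>

datatype 'v ugraph = UGraph (verts: "'v set") (edges: "'v set set")

definition simple_finite_graph :: "'v ugraph \<Rightarrow> bool" where
  "simple_finite_graph G \<longleftrightarrow>
     finite (verts G) \<and> (\<forall>e\<in>edges G. e \<subseteq> verts G \<and> card e = 2)"

definition connected_graph :: "'v ugraph \<Rightarrow> bool" where
  "connected_graph G \<longleftrightarrow>
     (\<forall>u\<in>verts G. \<forall>w\<in>verts G. (u, w) \<in> {(x, y). {x, y} \<in> edges G}\<^sup>*)"

definition graph_iso :: "'v ugraph \<Rightarrow> 'w ugraph \<Rightarrow> bool" where
  "graph_iso G H \<longleftrightarrow>
     (\<exists>f. bij_betw f (verts G) (verts H) \<and>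
          (\<forall>u\<in>verts G. \<forall>w\<in>verts G. {u, w} \<in> edges G \<longleftrightarrow> {f u, f w} \<in> edges H))"

definition graph_degree :: "'v ugraph \<Rightarrow> 'v \<Rightarrow> nat" where
  "graph_degree G v = card {e \<in> edges G. v \<in> e}"

abbreviation graph_order :: "'v ugraph \<Rightarrow> nat" where
  "graph_order G \<equiv> card (verts G)"

definition admissible_graph :: "'v ugraph \<Rightarrow> bool" where
  "admissible_graph G \<longleftrightarrow> verts G \<noteq> {} \<and> simple_finite_graph G \<and> connected_graph G"

text \<open>One representative per isomorphism class. Quantifying over graphs with vertices in
  \<^typ>\<open>nat\<close> reaches every isomorphism class of finite graphs.\<close>

definition community_graph_system :: "nat ugraph set \<Rightarrow> bool" where
  "community_graph_system HH \<longleftrightarrow>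
     (\<forall>H\<in>HH. admissible_graph H \<and> verts H = {1..graph_order H}) \<and>
     (\<forall>G :: nat ugraph. admissible_graph G \<longrightarrow> (\<exists>!H. H \<in> HH \<and> graph_iso G H))"


section \<open>Multigraphs\<close>

text \<open>Every edge has a multiset of two endpoints, which is \<open>{#v, v#}\<close> for a self-loop at
  \<open>v\<close>. Hence self-loops count twice in the degree.\<close>

datatype ('v, 'e) multigraph =
  Multigraph (mverts: "'v set") (medges: "'e set") (mends: "'e \<Rightarrow> 'v multiset")

definition deg :: "('v, 'e) multigraph \<Rightarrow> 'v \<Rightarrow> nat" where
  "deg G v = (\<Sum>e\<in>medges G. count (mends G e) v)"

definition empirical_degree_cdf :: "('v, 'e) multigraph \<Rightarrow> real \<Rightarrow> real" where
  "empirical_degree_cdf G x =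
     real (card {v \<in> mverts G. real (deg G v) \<le> x}) / real (card (mverts G))"


section \<open>The random intersection graph with communities\<close>

definition l_half_edges :: "nat \<Rightarrow> (nat \<Rightarrow> nat) \<Rightarrow> (nat \<times> nat) set" where
  "l_half_edges N dl = (SIGMA v:{1..N}. {1..dl v})"

definition r_half_edges :: "nat \<Rightarrow> (nat \<Rightarrow> nat ugraph) \<Rightarrow> (nat \<times> nat) set" where
  "r_half_edges M Com = (SIGMA a:{1..M}. {1..graph_order (Com a)})"

text \<open>The extensional function space makes a bijection between two sets a unique HOL
  function, so that the uniform distribution on this set is the intended one.\<close>

definition bijections :: "'a set \<Rightarrow> 'b set \<Rightarrow> ('a \<Rightarrow> 'b) set" where
  "bijections A B = {f \<in> A \<rightarrow>\<^sub>E B. bij_betw f A B}"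

definition role_holder ::
    "nat \<Rightarrow> (nat \<Rightarrow> nat) \<Rightarrow> (nat \<times> nat \<Rightarrow> nat \<times> nat) \<Rightarrow> nat \<times> nat \<Rightarrow> nat" where
  "role_holder N dl \<omega> j = fst (the_inv_into (l_half_edges N dl) \<omega> j)"

text \<open>An edge of the graph is a pair \<open>(a, e)\<close> of a community and an edge of its community
  graph, so that each community edge is copied separately.\<close>

definition rigc_of_matching ::
    "nat \<Rightarrow> (nat \<Rightarrow> nat) \<Rightarrow> nat \<Rightarrow> (nat \<Rightarrow> nat ugraph) \<Rightarrow> (nat \<times> nat \<Rightarrow> nat \<times> nat)
     \<Rightarrow> (nat, nat \<times> nat set) multigraph" where
  "rigc_of_matching N dl M Com \<omega> =
     Multigraph {1..N} (SIGMA a:{1..M}. edges (Com a))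
       (\<lambda>(a, e). image_mset (\<lambda>k. role_holder N dl \<omega> (a, k)) (mset_set e))"

definition RIGC ::
    "nat \<Rightarrow> (nat \<Rightarrow> nat) \<Rightarrow> nat \<Rightarrow> (nat \<Rightarrow> nat ugraph)
     \<Rightarrow> (nat, nat \<times> nat set) multigraph pmf" where
  "RIGC N dl M Com =
     map_pmf (rigc_of_matching N dl M Com)
       (pmf_of_set (bijections (l_half_edges N dl) (r_half_edges M Com)))"


section \<open>Laws of the degrees\<close>

definition l_degree_pmf :: "nat \<Rightarrow> (nat \<Rightarrow> nat) \<Rightarrow> nat pmf" where
  "l_degree_pmf N dl = map_pmf dl (pmf_of_set {1..N})"

definition r_degree_pmf :: "nat \<Rightarrow> (nat \<Rightarrow> nat ugraph) \<Rightarrow> nat pmf" where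
  "r_degree_pmf M Com = map_pmf (\<lambda>a. graph_order (Com a)) (pmf_of_set {1..M})"

definition community_frequency :: "nat \<Rightarrow> (nat \<Rightarrow> nat ugraph) \<Rightarrow> nat ugraph \<Rightarrow> real" where
  "community_frequency M Com H = real (card {a \<in> {1..M}. Com a = H}) / real M"

definition community_degree_pmf :: "nat \<Rightarrow> (nat \<Rightarrow> nat ugraph) \<Rightarrow> nat pmf" where
  "community_degree_pmf M Com =
     map_pmf (\<lambda>(a, k). graph_degree (Com a) k) (pmf_of_set (r_half_edges M Com))"

definition rigc_degree_pmf ::
    "nat \<Rightarrow> (nat \<Rightarrow> nat) \<Rightarrow> nat \<Rightarrow> (nat \<Rightarrow> nat ugraph) \<Rightarrow> nat pmf" where
  "rigc_degree_pmf N dl M Com =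
     bind_pmf (RIGC N dl M Com) (\<lambda>G. map_pmf (deg G) (pmf_of_set (mverts G)))"

text \<open>The law of an integer-valued variable as a distribution on the real line, as required
  by \<^const>\<open>weak_conv_m\<close>.\<close>

definition real_law :: "nat pmf \<Rightarrow> real measure" where
  "real_law p = distr (measure_pmf p) borel real"

text \<open>Weak limits are unique, but this describes a specific law only if the sequence
  converges.\<close>

definition limit_law :: "(nat \<Rightarrow> real measure) \<Rightarrow> real measure" where
  "limit_law L = (THE l. real_distribution l \<and> weak_conv_m L l)"

end

theory Submission
  imports Defs
begin

text \<open>
  The degree of an individual is the sum of the community degrees of the roles taken by its
  half-edges. Since a uniformly random bijection maps a uniform point to a uniform point, the image
  of one more half-edge may be replaced by an independent uniform role at a cost of
  \<open>k / h\<close> once \<open>k\<close> half-edges have been matched (\<open>h\<close> being the number of half-edges); no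
  control of the community degrees is needed. Applied to one and to two individuals with at most
  \<open>K\<close> memberships, this bounds the second moment of the difference between the empirical
  distribution function and that of a random sum by
  \<open>1 / N + 3 K\<^sup>2 / h + 2 \<P>(D\<^sup>l > K)\<close>, which tends to zero when first \<open>n\<close> and then \<open>K\<close> tends to
  infinity. The role of a uniform half-edge lies in a size-biased community, so its degree converges
  in law; pointwise limits of probability mass functions pass through mixtures and convolutions,
  which identifies the limit. Uniformity in \<open>x\<close> holds because all the distribution functions
  are step functions on the integers and the limit has total mass one.
\<close>

section \<open>Pointwise convergence of probability mass functions\<close>

text \<open>Pointwise convergence makes sense on any type, so the same notion serves for degrees and
  for community graphs, which carry no topology.\<close>

definition pmf_tendsto :: "(nat \<Rightarrow> 'a pmf) \<Rightarrow> 'a pmf \<Rightarrow> bool" where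
  "pmf_tendsto p q \<longleftrightarrow> (\<forall>x. (\<lambda>n. pmf (p n) x) \<longlonglongrightarrow> pmf q x)"

lemma pmf_tendstoD: "pmf_tendsto p q \<Longrightarrow> (\<lambda>n. pmf (p n) x) \<longlonglongrightarrow> pmf q x"
  by (simp add: pmf_tendsto_def)

lemma integrable_pmf_bounded:
  fixes f :: "'a \<Rightarrow> real"
  assumes "\<And>x. \<bar>f x\<bar> \<le> B"
  shows "integrable (measure_pmf p) f"
  using assms by (intro measure_pmf.integrable_const_bound[where B=B]) auto

text \<open>As \<open>f\<close> is bounded by one, the part of the expectation outside
  \<open>A\<close> is at most the mass outside \<open>A\<close>.\<close>

lemma expectation_pmf_finite_approx:
  fixes f :: "'a \<Rightarrow> real"
  assumes "finite A" and bd: "\<And>x. \<bar>f x\<bar> \<le> 1"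
  shows "\<bar>measure_pmf.expectation p f - (\<Sum>x\<in>A. pmf p x * f x)\<bar> \<le> 1 - (\<Sum>x\<in>A. pmf p x)"
proof -
  have int: "integrable (measure_pmf p) f"
    using bd by (rule integrable_pmf_bounded)
  have int_ind: "integrable (measure_pmf p) (\<lambda>x. indicator A x * f x)"
    by (rule integrable_pmf_bounded[where B=1]) (auto simp: indicator_def bd)
  have sumA: "(\<Sum>x\<in>A. pmf p x * f x) = measure_pmf.expectation p (\<lambda>x. indicator A x * f x)"
    by (subst integral_measure_pmf[OF \<open>finite A\<close>]) (auto simp: indicator_def split: if_splits)
  have "\<bar>measure_pmf.expectation p f - (\<Sum>x\<in>A. pmf p x * f x)\<bar>
      = \<bar>measure_pmf.expectation p (\<lambda>x. f x - indicator A x * f x)\<bar>"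
    by (simp add: sumA int int_ind)
  also have "\<dots> \<le> measure_pmf.expectation p (\<lambda>x. \<bar>f x - indicator A x * f x\<bar>)"
    by (rule integral_abs_bound)
  also have "\<dots> \<le> measure_pmf.expectation p (\<lambda>x. 1 - indicator A x)"
    by (rule integral_mono)
       (auto simp: indicator_def bd intro!: integrable_pmf_bounded[where B=1] Bochner_Integration.integrable_diff int)
  also have "\<dots> = 1 - measure_pmf.prob p A"
    by (subst Bochner_Integration.integral_diff)
       (auto intro!: integrable_pmf_bounded[where B=1] simp: indicator_def)
  also have "measure_pmf.prob p A = (\<Sum>x\<in>A. pmf p x)"
    using \<open>finite A\<close> by (rule measure_measure_pmf_finite)
  finally show ?thesis .
qed

text \<open>Tightness of a single law: the masses have unconditional sum one, so some finite partial
  sum comes within \<open>e\<close> of it.\<close>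

lemma pmf_finite_mass:
  assumes "e > (0::real)"
  obtains A where "finite A" "(\<Sum>x\<in>A. pmf p x) > 1 - e"
proof -
  have "(pmf p has_sum 1) UNIV"
  proof -
    have "infsetsum (pmf p) UNIV = 1"
      by (rule infsetsum_pmf_eq_1) auto
    moreover have "pmf p summable_on UNIV"
      using pmf_abs_summable[of p UNIV] abs_summable_equivalent abs_summable_summable by blast
    ultimately show ?thesis
      using infsetsum_infsum[OF pmf_abs_summable[of p UNIV]] has_sum_infsum by fastforce
  qed
  then have "(sum (pmf p) \<longlongrightarrow> 1) (finite_subsets_at_top UNIV)"
    by (simp add: has_sum_def)
  then have "\<forall>\<^sub>F A in finite_subsets_at_top UNIV. sum (pmf p) A > 1 - e"
    by (rule order_tendstoD(1)) (use assms in auto)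
  then obtain A where "finite A" "sum (pmf p) A > 1 - e"
    unfolding eventually_finite_subsets_at_top by blast
  then show thesis by (rule that)
qed

text \<open>No mass can escape because the limit is again a probability mass function.\<close>

lemma expectation_tendsto:
  fixes f :: "nat \<Rightarrow> 'a \<Rightarrow> real"
  assumes p: "pmf_tendsto p q"
    and f: "\<And>x. (\<lambda>n. f n x) \<longlonglongrightarrow> g x"
    and bd: "\<And>n x. \<bar>f n x\<bar> \<le> 1"
  shows "(\<lambda>n. measure_pmf.expectation (p n) (f n)) \<longlonglongrightarrow> measure_pmf.expectation q g"
proof (rule LIMSEQ_I)
  fix r :: real assume "r > 0"
  have bdg: "\<bar>g x\<bar> \<le> 1" for x
    using tendsto_rabs[OF f] bd by (rule tendsto_upperbound[OF _ eventuallyI]) auto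
  \<comment> \<open>Three errors below \<open>r/4\<close> are added: the mass of \<open>p n\<close>
    outside \<open>A\<close>, the difference of the finite sums, and the mass of \<open>q\<close>
    outside \<open>A\<close>.\<close>
  obtain A where A: "finite A" "(\<Sum>x\<in>A. pmf q x) > 1 - r/4"
    using pmf_finite_mass[of "r/4" q] \<open>r > 0\<close> by auto
  have "(\<lambda>n. \<Sum>x\<in>A. pmf (p n) x) \<longlonglongrightarrow> (\<Sum>x\<in>A. pmf q x)"
    by (intro tendsto_sum pmf_tendstoD p)
  then have 1: "\<forall>\<^sub>F n in sequentially. (\<Sum>x\<in>A. pmf (p n) x) > 1 - r/4"
    using A by (intro order_tendstoD(1))
  have "(\<lambda>n. \<Sum>x\<in>A. pmf (p n) x * f n x) \<longlonglongrightarrow> (\<Sum>x\<in>A. pmf q x * g x)"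
    by (intro tendsto_intros pmf_tendstoD p f)
  then have 2: "\<forall>\<^sub>F n in sequentially. dist (\<Sum>x\<in>A. pmf (p n) x * f n x) (\<Sum>x\<in>A. pmf q x * g x) < r/4"
    by (rule tendstoD) (use \<open>r > 0\<close> in simp)
  have "\<forall>\<^sub>F n in sequentially.
      norm (measure_pmf.expectation (p n) (f n) - measure_pmf.expectation q g) < r"
    using 1 2
  proof eventually_elim
    case (elim n)
    show ?case
      using elim A expectation_pmf_finite_approx[where f="f n" and p="p n", OF A(1) bd]
        expectation_pmf_finite_approx[where f=g and p=q, OF A(1) bdg]
      unfolding dist_real_def real_norm_def by linarith
  qed
  then show "\<exists>no. \<forall>n\<ge>no. norm (measure_pmf.expectation (p n) (f n) - measure_pmf.expectation q g) < r"
    by (simp add: eventually_sequentially)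
qed

text \<open>The mass of a mixture at a point is an expectation of values in the unit interval, so
  the mixing law and the kernel may vary with \<open>n\<close> together.\<close>

lemma pmf_tendsto_bind:
  assumes "pmf_tendsto p q" "\<And>x. pmf_tendsto (\<lambda>n. f n x) (g x)"
  shows "pmf_tendsto (\<lambda>n. bind_pmf (p n) (f n)) (bind_pmf q g)"
  unfolding pmf_tendsto_def pmf_bind
  using assms by (auto intro!: expectation_tendsto pmf_tendstoD simp: pmf_le_1)

lemma pmf_tendsto_const: "pmf_tendsto (\<lambda>_. p) p"
  by (simp add: pmf_tendsto_def)

lemma pmf_tendsto_map:
  assumes "pmf_tendsto p q"
  shows "pmf_tendsto (\<lambda>n. map_pmf f (p n)) (map_pmf f q)"
  unfolding map_pmf_def by (intro pmf_tendsto_bind assms pmf_tendsto_const)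

lemma prob_tendsto:
  assumes "pmf_tendsto p q"
  shows "(\<lambda>n. measure_pmf.prob (p n) A) \<longlonglongrightarrow> measure_pmf.prob q A"
  using expectation_tendsto[OF assms, of "\<lambda>_. indicator A" "indicator A"]
  by (simp add: indicator_def)

section \<open>Integer-valued laws on the real line and their weak convergence\<close>

lemma real_distribution_real_law: "real_distribution (real_law p)"
proof -
  interpret prob_space "real_law p"
    unfolding real_law_def by (rule measure_pmf.prob_space_distr) simp
  show ?thesis by unfold_locales (auto simp: real_law_def)
qed

lemma cdf_real_law: "cdf (real_law p) x = measure_pmf.prob p {k. real k \<le> x}"
  unfolding cdf_def real_law_def by (subst measure_distr) (auto simp: vimage_def)

lemma weak_conv_real_law:
  assumes "pmf_tendsto p q"
  shows "weak_conv_m (\<lambda>n. real_law (p n)) (real_law q)"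
  unfolding weak_conv_m_def weak_conv_def cdf_real_law using prob_tendsto[OF assms] by blast

lemma isCont_cdf_real_law:
  assumes "\<And>k. x \<noteq> real k"
  shows "isCont (cdf (real_law p)) x"
proof -
  interpret real_distribution "real_law p" by (rule real_distribution_real_law)
  have "measure (real_law p) {x} = measure_pmf.prob p {k. real k = x}"
    unfolding real_law_def by (subst measure_distr) (auto simp: vimage_def)
  also have "{k. real k = x} = {}" using assms by auto
  finally show ?thesis by (simp add: isCont_cdf)
qed

text \<open>The jump at \<open>k\<close> is read off at the neighbouring half-integers because these
  are continuity points of every such distribution function, where weak convergence gives
  information.\<close>

lemma pmf_eq_cdf_diff:
  "pmf p k = cdf (real_law p) (real k + 1/2) - cdf (real_law p) (real k - 1/2)"
proof -
  have "{j. real j \<le> real k + 1/2} = {j. real j \<le> real k - 1/2} \<union> {k}"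
    by (auto; linarith)
  then have "measure_pmf.prob p {j. real j \<le> real k + 1/2}
      = measure_pmf.prob p {j. real j \<le> real k - 1/2} + measure_pmf.prob p {k}"
    by (simp only:) (rule measure_pmf.finite_measure_Union, auto)
  then show ?thesis by (simp add: cdf_real_law measure_pmf_single)
qed

lemma pmf_tendsto_of_weak_conv:
  assumes "weak_conv_m (\<lambda>n. real_law (p n)) (real_law q)"
  shows "pmf_tendsto p q"
proof -
  \<comment> \<open>Half-integers are not integers: after doubling, this is a matter of
    parity.\<close>
  have nc: "real k + 1/2 \<noteq> real j" "real k - 1/2 \<noteq> real j" for k j :: nat
  proof -
    have "2 * k + 1 \<noteq> 2 * j" "2 * k \<noteq> 2 * j + 1" by presburger+
    then have "real (2 * k + 1) \<noteq> real (2 * j)" "real (2 * k) \<noteq> real (2 * j + 1)"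
      by (simp_all only: of_nat_eq_iff not_False_eq_True)
    then show "real k + 1/2 \<noteq> real j" "real k - 1/2 \<noteq> real j" by auto
  qed
  have lim: "(\<lambda>n. cdf (real_law (p n)) x) \<longlonglongrightarrow> cdf (real_law q) x" if "\<And>j. x \<noteq> real j" for x
    using assms isCont_cdf_real_law[OF that] unfolding weak_conv_m_def weak_conv_def by blast
  show ?thesis
    unfolding pmf_tendsto_def pmf_eq_cdf_diff by (intro allI tendsto_diff lim nc)
qed

text \<open>Two weak limits of the same sequence have the same characteristic function by Levy
  continuity, hence coincide; this evaluates the definite description.\<close>

lemma limit_law_eqI:
  assumes "\<And>n. real_distribution (L n)" "real_distribution l" "weak_conv_m L l"
  shows "limit_law L = l"
  unfolding limit_law_def
proof (rule the_equality)
  fix l' assume l': "real_distribution l' \<and> weak_conv_m L l'"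
  have "char l' t = char l t" for t
    using levy_continuity1[where M=L and M'=l' and t=t] levy_continuity1[where M=L and M'=l and t=t]
      assms l' LIMSEQ_unique by blast
  then show "l' = l" using l' assms by (intro Levy_uniqueness) auto
qed (use assms in blast)

text \<open>Bridge from a variable on an arbitrary probability space to a probability mass
  function.\<close>

lemma distr_real_eq_real_law:
  assumes "prob_space P" and X: "X \<in> measurable P (count_space (UNIV :: nat set))"
  obtains p where "distr P borel (\<lambda>\<omega>. real (X \<omega>)) = real_law p"
    "\<And>k. pmf p k = measure P {\<omega> \<in> space P. X \<omega> = k}"
proof -
  interpret prob_space P by fact
  let ?D = "distr P (count_space UNIV) X"
  interpret D: prob_space ?D using X by (rule prob_space_distr)
  \<comment> \<open>\<open>Abs_pmf\<close> is meaningful only if almost every point is an atom; the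
    points without mass form a countable union of null singletons.\<close>
  have "{k. measure ?D {k} = 0} \<in> null_sets ?D"
  proof -
    have "(\<Union>k\<in>{k. measure ?D {k} = 0}. {k}) \<in> null_sets ?D"
      by (rule null_sets_UN') (auto simp: null_sets_def D.emeasure_eq_measure)
    then show ?thesis by simp
  qed
  then have "AE k in ?D. measure ?D {k} \<noteq> 0"
    by (rule AE_I') auto
  then have D: "measure_pmf (Abs_pmf ?D) = ?D"
    using D.prob_space_axioms by (intro Abs_pmf_inverse) auto
  have "pmf (Abs_pmf ?D) k = measure P {\<omega> \<in> space P. X \<omega> = k}" for k
    unfolding measure_pmf_single[symmetric] D
    using X by (subst measure_distr) (auto intro!: arg_cong[where f="measure P"])
  moreover have "distr P borel (\<lambda>\<omega>. real (X \<omega>)) = real_law (Abs_pmf ?D)"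
    unfolding real_law_def D using X by (subst distr_distr) (auto simp: comp_def)
  ultimately show thesis using that by blast
qed

section \<open>Sums of independent integer-valued variables\<close>

text \<open>The \<open>k\<close>-fold convolution of \<open>p\<close>. The recursion splits off one
  summand, which matches the later replacement of one half-edge at a time.\<close>

primrec conv_power :: "nat pmf \<Rightarrow> nat \<Rightarrow> nat pmf" where
  "conv_power p 0 = return_pmf 0"
| "conv_power p (Suc k) = bind_pmf p (\<lambda>x. map_pmf ((+) x) (conv_power p k))"

lemma pmf_tendsto_conv_power:
  assumes "pmf_tendsto p q"
  shows "pmf_tendsto (\<lambda>n. conv_power (p n) k) (conv_power q k)"
proof (induction k)
  case 0
  show ?case by (simp add: pmf_tendsto_const)
next
  case (Suc k)
  show ?case
    unfolding conv_power.simps by (intro pmf_tendsto_bind pmf_tendsto_map assms Suc)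
qed

lemma expectation_bind_pmf:
  fixes f :: "'b \<Rightarrow> real"
  assumes "\<And>x. \<bar>f x\<bar> \<le> B"
  shows "measure_pmf.expectation (bind_pmf p g) f
       = measure_pmf.expectation p (\<lambda>x. measure_pmf.expectation (g x) f)"
  unfolding measure_pmf_bind
  by (rule integral_bind[where K="count_space UNIV" and B=B and B'=1])
     (auto simp: assms measure_pmf.emeasure_eq_1_AE measure_pmf.emeasure_space_1
       measure_subprob measure_pmf.finite_measure)

text \<open>Needed for characteristic functions; the real version applies to the real and the
  imaginary part separately.\<close>

lemma expectation_bind_pmf_complex:
  fixes f :: "'b \<Rightarrow> complex"
  assumes "\<And>x. cmod (f x) \<le> B"
  shows "measure_pmf.expectation (bind_pmf p g) f
       = measure_pmf.expectation p (\<lambda>x. measure_pmf.expectation (g x) f)"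
proof -
  have int: "integrable (measure_pmf q) f" for q
    by (rule measure_pmf.integrable_const_bound[where B=B]) (auto simp: assms)
  have int2: "integrable (measure_pmf p) (\<lambda>x. measure_pmf.expectation (g x) f)"
  proof (rule measure_pmf.integrable_const_bound[where B=B])
    have "norm (measure_pmf.expectation q f) \<le> measure_pmf.expectation q (\<lambda>_. B)" for q
      by (rule order_trans[OF integral_norm_bound], rule integral_mono) (auto simp: int assms)
    then show "AE x in measure_pmf p. norm (measure_pmf.expectation (g x) f) \<le> B" by simp
  qed simp
  have "\<bar>Re (f x)\<bar> \<le> B" "\<bar>Im (f x)\<bar> \<le> B" for x
    using abs_Re_le_cmod[of "f x"] abs_Im_le_cmod[of "f x"] assms[of x] by linarith+
  then show ?thesis
    using int int2 by (simp add: complex_eq_iff integral_Re[symmetric] integral_Im[symmetric]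
        expectation_bind_pmf[where B=B] del: integral_Re integral_Im)
qed

lemma expectation_conv_power_Suc:
  fixes f :: "nat \<Rightarrow> real"
  assumes "\<And>x. \<bar>f x\<bar> \<le> B"
  shows "measure_pmf.expectation (conv_power p (Suc k)) f
       = measure_pmf.expectation p (\<lambda>x. measure_pmf.expectation (conv_power p k) (\<lambda>y. f (x + y)))"
  by (simp add: expectation_bind_pmf[where B=B] assms)

section \<open>Characteristic functions of convolutions and random sums\<close>

lemma char_real_law: "char (real_law p) t = measure_pmf.expectation p (\<lambda>k. iexp (t * real k))"
  unfolding char_def real_law_def by (subst integral_distr) auto

lemma char_real_law_bind:
  "char (real_law (bind_pmf p g)) t = measure_pmf.expectation p (\<lambda>x. char (real_law (g x)) t)"
  unfolding char_real_law by (rule expectation_bind_pmf_complex[where B=1]) simp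

lemma char_conv_power: "char (real_law (conv_power p k)) t = char (real_law p) t ^ k"
proof (induction k)
  case 0
  show ?case by (simp add: char_real_law)
next
  case (Suc k)
  have "char (real_law (map_pmf ((+) x) (conv_power p k))) t
      = iexp (t * real x) * char (real_law (conv_power p k)) t" for x
    by (simp add: char_real_law distrib_left exp_add)
  then have "char (real_law (conv_power p (Suc k))) t
      = measure_pmf.expectation p (\<lambda>x. iexp (t * real x) * char (real_law p) t ^ k)"
    by (simp add: char_real_law_bind Suc)
  also have "\<dots> = char (real_law p) t * char (real_law p) t ^ k"
    unfolding char_real_law[of p] by (rule integral_mult_left_zero)
  finally show ?case by simp
qed

text \<open>Puts the expectation in the form of a series, to be compared with a partition of a
  probability space by the value of an integer variable.\<close>

lemma expectation_nat_suminf: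
  fixes f :: "nat \<Rightarrow> complex"
  assumes "\<And>k. cmod (f k) \<le> B"
  shows "measure_pmf.expectation p f = (\<Sum>k. pmf p k * f k)"
proof -
  have UN: "(\<Union>k. {k}) = (UNIV :: nat set)" by auto
  have int: "integrable (measure_pmf p) f"
    by (rule measure_pmf.integrable_const_bound[where B=B]) (auto simp: assms)
  have "(LINT k:(\<Union>k. {k})|measure_pmf p. f k) = (\<Sum>i. LINT k:{i}|measure_pmf p. f k)"
    by (rule lebesgue_integral_countable_add) (auto simp: UN set_integrable_def int)
  moreover have "(LINT k:{i}|measure_pmf p. f k) = pmf p i * f i" for i
    unfolding set_lebesgue_integral_def
    by (subst integral_measure_pmf[of "{i}"]) (auto simp: indicator_def scaleR_conv_of_real split: if_splits)
  ultimately show ?thesis by (simp add: UN set_lebesgue_integral_def)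
qed

text \<open>On the event \<open>Dl = k\<close> the sum has a fixed number of terms and independence
  factorises its characteristic function. Summing over \<open>k\<close> gives that of the mixture,
  and Levy uniqueness identifies the law. Index 0 of the family carries \<open>Dl\<close>, so joint
  independence also covers the number of terms.\<close>

lemma (in prob_space) distr_random_sum:
  fixes Dl :: "'a \<Rightarrow> nat" and Dc :: "nat \<Rightarrow> 'a \<Rightarrow> real"
  assumes indep: "indep_vars (\<lambda>_. borel)
      (\<lambda>i. if i = 0 then (\<lambda>\<omega>. real (Dl \<omega>)) else Dc i) (UNIV :: nat set)"
    and l: "\<And>k. pmf l k = prob {\<omega> \<in> space M. Dl \<omega> = k}"
    and p: "\<And>i. i \<ge> 1 \<Longrightarrow> distr M borel (Dc i) = real_law p"
  shows "(\<lambda>\<omega>. \<Sum>i=1..Dl \<omega>. Dc i \<omega>) \<in> borel_measurable M"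
    and "distr M borel (\<lambda>\<omega>. \<Sum>i=1..Dl \<omega>. Dc i \<omega>) = real_law (bind_pmf l (conv_power p))"
proof -
  have rv: "(\<lambda>\<omega>. real (Dl \<omega>)) \<in> borel_measurable M" "\<And>i. i \<ge> 1 \<Longrightarrow> Dc i \<in> borel_measurable M"
    using indep unfolding indep_vars_def
    by (metis UNIV_I, metis UNIV_I not_one_le_zero)
  \<comment> \<open>The independent family is real-valued; taking the floor recovers measurability
    of \<open>Dl\<close> as an integer variable.\<close>
  have "(\<lambda>\<omega>. nat \<lfloor>real (Dl \<omega>)\<rfloor>) \<in> measurable M (count_space UNIV)"
    using rv(1) by measurable
  then have Dl [measurable]: "Dl \<in> measurable M (count_space UNIV)" by simp
  show Dp [measurable]: "(\<lambda>\<omega>. \<Sum>i=1..Dl \<omega>. Dc i \<omega>) \<in> borel_measurable M"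
    by (rule measurable_compose_countable[where f="\<lambda>k \<omega>. \<Sum>i=1..k. Dc i \<omega>", OF borel_measurable_sum Dl])
       (use rv(2) in auto)
  let ?S = "\<lambda>\<omega>. \<Sum>i=1..Dl \<omega>. Dc i \<omega>"
  have part: "(CLINT \<omega>:{\<omega>\<in>space M. Dl \<omega> = k}|M. iexp (t * ?S \<omega>)) = pmf l k * char (real_law p) t ^ k" for k t
  proof -
    \<comment> \<open>With the indicator of \<open>k\<close> at index 0 and exponentials elsewhere,
      the product over \<open>{0..k}\<close> is exactly the integrand restricted to
      \<open>Dl = k\<close>.\<close>
    define Z where "Z = (\<lambda>(i::nat) x. if i = 0 then complex_of_real (indicator {real k} x) else iexp (t * x))"
    let ?W = "\<lambda>i \<omega>. Z i ((if i = 0 then (\<lambda>\<omega>. real (Dl \<omega>)) else Dc i) \<omega>)"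
    have Zm: "Z i \<in> borel_measurable borel" for i
      unfolding Z_def by (cases "i = 0") simp_all
    have indepW: "indep_vars (\<lambda>_. borel) ?W {0..k}"
      by (rule indep_vars_subset[OF indep_vars_compose2[OF indep]]) (auto intro: Zm)
    have intW: "integrable M (?W i)" for i
    proof (rule integrable_const_bound[where B=1])
      show "AE \<omega> in M. norm (?W i \<omega>) \<le> 1" by (auto simp: Z_def indicator_def)
      show "?W i \<in> borel_measurable M"
        using measurable_compose[OF rv(1) Zm] measurable_compose[OF rv(2) Zm] by (cases "i = 0") simp_all
    qed
    have "(\<integral>\<omega>. (\<Prod>i\<in>{0..k}. ?W i \<omega>) \<partial>M) = (\<Prod>i\<in>{0..k}. \<integral>\<omega>. ?W i \<omega> \<partial>M)"
      by (rule indep_vars_lebesgue_integral[OF _ indepW intW]) simp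
    also have "{0..k} = insert 0 {1..k}" by auto
    also have "(\<Prod>i\<in>insert 0 {1..k}. \<integral>\<omega>. ?W i \<omega> \<partial>M) = (\<integral>\<omega>. ?W 0 \<omega> \<partial>M) * (\<Prod>i\<in>{1..k}. \<integral>\<omega>. ?W i \<omega> \<partial>M)"
      by simp
    also have "(\<integral>\<omega>. ?W 0 \<omega> \<partial>M) = pmf l k"
    proof -
      have "(\<integral>\<omega>. ?W 0 \<omega> \<partial>M) = (\<integral>\<omega>. complex_of_real (indicator {\<omega>\<in>space M. Dl \<omega> = k} \<omega>) \<partial>M)"
        by (rule Bochner_Integration.integral_cong) (auto simp: Z_def indicator_def)
      then show ?thesis by (simp add: l)
    qed
    also have "(\<Prod>i\<in>{1..k}. \<integral>\<omega>. ?W i \<omega> \<partial>M) = (\<Prod>i\<in>{1..k}. char (real_law p) t)"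
    proof (rule prod.cong[OF refl])
      fix i assume i: "i \<in> {1..k}"
      then have "(\<integral>\<omega>. ?W i \<omega> \<partial>M) = char (distr M borel (Dc i)) t"
        unfolding char_def using rv(2)[of i] by (subst integral_distr) (auto simp: Z_def)
      then show "(\<integral>\<omega>. ?W i \<omega> \<partial>M) = char (real_law p) t" using i p by simp
    qed
    also have "(\<integral>\<omega>. (\<Prod>i\<in>insert 0 {1..k}. ?W i \<omega>) \<partial>M) = (CLINT \<omega>:{\<omega>\<in>space M. Dl \<omega> = k}|M. iexp (t * ?S \<omega>))"
      unfolding set_lebesgue_integral_def
    proof (rule Bochner_Integration.integral_cong[OF refl])
      fix \<omega> assume "\<omega> \<in> space M"
      have "(\<Prod>i\<in>{1..k}. ?W i \<omega>) = (\<Prod>i\<in>{1..k}. iexp (t * Dc i \<omega>))"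
        by (rule prod.cong) (auto simp: Z_def)
      also have "\<dots> = iexp (t * (\<Sum>i=1..k. Dc i \<omega>))"
        by (simp add: exp_sum sum_distrib_left)
      finally have "(\<Prod>i\<in>{1..k}. ?W i \<omega>) = iexp (t * (\<Sum>i=1..k. Dc i \<omega>))" .
      then show "(\<Prod>i\<in>insert 0 {1..k}. ?W i \<omega>) = indicator {\<omega>\<in>space M. Dl \<omega> = k} \<omega> *\<^sub>R iexp (t * ?S \<omega>)"
        using \<open>\<omega> \<in> space M\<close> by (auto simp: Z_def indicator_def)
    qed
    finally show ?thesis by simp
  qed
  have "char (distr M borel ?S) t = char (real_law (bind_pmf l (conv_power p))) t" for t
  proof -
    have int_S: "integrable M (\<lambda>\<omega>. iexp (t * ?S \<omega>))"
      by (rule integrable_const_bound[where B=1])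
         (use measurable_compose[OF Dp, of "\<lambda>x. iexp (t * x)"] in simp_all)
    have UN: "(\<Union>k. {\<omega>\<in>space M. Dl \<omega> = k}) = space M" by auto
    have "char (distr M borel ?S) t = (CLINT \<omega>:(\<Union>k. {\<omega>\<in>space M. Dl \<omega> = k})|M. iexp (t * ?S \<omega>))"
      unfolding char_def UN by (subst integral_distr[OF Dp]) (simp, rule set_integral_space[OF int_S, symmetric])
    also have "\<dots> = (\<Sum>k. CLINT \<omega>:{\<omega>\<in>space M. Dl \<omega> = k}|M. iexp (t * ?S \<omega>))"
    proof (rule lebesgue_integral_countable_add)
      show "set_integrable M (\<Union>k. {\<omega>\<in>space M. Dl \<omega> = k}) (\<lambda>\<omega>. iexp (t * ?S \<omega>))"
        unfolding UN set_integrable_def by (rule integrable_mult_indicator[OF sets.top int_S])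
    qed auto
    also have "\<dots> = measure_pmf.expectation l (\<lambda>k. char (real_law p) t ^ k)"
      unfolding part using real_distribution.cmod_char_le_1[OF real_distribution_real_law]
      by (intro expectation_nat_suminf[symmetric, where B=1]) (simp add: norm_power power_le_one)
    also have "\<dots> = char (real_law (bind_pmf l (conv_power p))) t"
      by (simp add: char_real_law_bind char_conv_power)
    finally show ?thesis .
  qed
  then show "distr M borel ?S = real_law (bind_pmf l (conv_power p))"
    by (intro Levy_uniqueness real_distribution_real_law real_distribution_distr[OF Dp] ext)
qed

section \<open>Degrees of community roles\<close>

lemma card_r_half_edges: "card (r_half_edges M Com) = (\<Sum>a\<in>{1..M}. graph_order (Com a))"
  by (simp add: r_half_edges_def)

lemma card_l_half_edges: "card (l_half_edges N dl) = (\<Sum>v\<in>{1..N}. dl v)"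
  by (simp add: l_half_edges_def)

lemma finite_half_edges [simp]:
  "finite (r_half_edges M Com)" "finite (l_half_edges N dl)"
  by (auto simp: r_half_edges_def l_half_edges_def)

text \<open>A uniform role hits a community with probability proportional to its order, so this is
  the size-biased law of the community graph.\<close>

definition role_community_pmf :: "nat \<Rightarrow> (nat \<Rightarrow> nat ugraph) \<Rightarrow> nat ugraph pmf" where
  "role_community_pmf M Com = map_pmf (\<lambda>(a, k). Com a) (pmf_of_set (r_half_edges M Com))"

definition vertex_degree_pmf :: "nat ugraph \<Rightarrow> nat pmf" where
  "vertex_degree_pmf H = map_pmf (graph_degree H) (pmf_of_set (verts H))"

lemma sum_r_half_edges:
  "(\<Sum>(a, k)\<in>r_half_edges M Com. f a k) = (\<Sum>a\<in>{1..M}. \<Sum>k\<in>{1..graph_order (Com a)}. f a k)"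
  unfolding r_half_edges_def by (rule sum.Sigma[symmetric]) auto

lemma pmf_eq_expectation: "pmf p x = measure_pmf.expectation p (\<lambda>y. of_bool (y = x))"
proof -
  have "(\<lambda>y. of_bool (y = x) :: real) = indicator {x}" by (auto simp: indicator_def)
  then show ?thesis by (simp add: measure_pmf_single)
qed

text \<open>Given its community, a uniform role is a uniform vertex of it: within each community the
  sum over the roles is unchanged when every term is replaced by the average.\<close>

lemma community_degree_pmf_eq_bind:
  assumes ne: "r_half_edges M Com \<noteq> {}"
    and verts: "\<And>a. a \<in> {1..M} \<Longrightarrow> verts (Com a) = {1..graph_order (Com a)}"
  shows "community_degree_pmf M Com = bind_pmf (role_community_pmf M Com) vertex_degree_pmf"
proof (rule pmf_eqI)
  fix d
  let ?R = "r_half_edges M Com"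
  have deg: "(\<Sum>k\<in>{1..graph_order (Com a)}. pmf (vertex_degree_pmf (Com a)) d)
      = (\<Sum>k\<in>{1..graph_order (Com a)}. of_bool (graph_degree (Com a) k = d))"
    if a: "a \<in> {1..M}" for a
  \<comment> \<open>For a community of order 0 both sums are empty, so the uniform law on the empty
    set is never evaluated.\<close>
  proof (cases "graph_order (Com a) = 0")
    case False
    have [simp]: "verts (Com a) \<noteq> {}" "finite (verts (Com a))"
      using False by (auto simp: card_eq_0_iff)
    have "pmf (vertex_degree_pmf (Com a)) d
        = measure_pmf.expectation (vertex_degree_pmf (Com a)) (\<lambda>y. of_bool (y = d))"
      by (rule pmf_eq_expectation)
    also have "\<dots> = (\<Sum>k\<in>verts (Com a). of_bool (graph_degree (Com a) k = d)) / graph_order (Com a)"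
      by (simp add: vertex_degree_pmf_def integral_pmf_of_set)
    finally show ?thesis
      using False unfolding verts[OF a, symmetric] by simp
  qed simp
  have "pmf (community_degree_pmf M Com) d
      = measure_pmf.expectation (community_degree_pmf M Com) (\<lambda>y. of_bool (y = d))"
    by (rule pmf_eq_expectation)
  also have "\<dots> = (\<Sum>(a, k)\<in>?R. of_bool (graph_degree (Com a) k = d)) / card ?R"
    using ne by (simp add: community_degree_pmf_def integral_pmf_of_set case_prod_beta)
  also have "(\<Sum>(a, k)\<in>?R. of_bool (graph_degree (Com a) k = d))
      = (\<Sum>(a, k)\<in>?R. pmf (vertex_degree_pmf (Com a)) d)"
    unfolding sum_r_half_edges by (intro sum.cong refl deg[symmetric])
  also have "\<dots> / card ?R = pmf (bind_pmf (role_community_pmf M Com) vertex_degree_pmf) d"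
    using ne by (simp add: pmf_bind role_community_pmf_def integral_pmf_of_set case_prod_beta)
  finally show "pmf (community_degree_pmf M Com) d = \<dots>" .
qed

text \<open>Size-biasing made explicit: each copy of \<open>H\<close> carries
  \<open>graph_order H\<close> roles, and dividing both the favourable and the total number of roles
  by \<open>M\<close> gives the frequency and the mean \<open>r\<close>-degree.\<close>

lemma pmf_role_community:
  assumes ne: "r_half_edges M Com \<noteq> {}"
  shows "pmf (role_community_pmf M Com) H = real (graph_order H) * community_frequency M Com H
       / measure_pmf.expectation (r_degree_pmf M Com) real"
proof -
  let ?R = "r_half_edges M Com"
  have M: "M > 0" using ne by (auto simp: r_half_edges_def intro: ccontr)
  have "pmf (role_community_pmf M Com) H
      = measure_pmf.expectation (role_community_pmf M Com) (\<lambda>y. of_bool (y = H))"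
    by (rule pmf_eq_expectation)
  also have "\<dots> = (\<Sum>(a, k)\<in>?R. of_bool (Com a = H)) / card ?R"
    using ne by (simp add: role_community_pmf_def integral_pmf_of_set case_prod_beta)
  also have "(\<Sum>(a, k)\<in>?R. of_bool (Com a = H)) = (\<Sum>a\<in>{1..M}. real (graph_order H) * of_bool (Com a = H))"
    unfolding sum_r_half_edges by (intro sum.cong) auto
  also have "\<dots> = real (graph_order H) * (\<Sum>a\<in>{1..M}. of_bool (Com a = H))"
    by (simp add: sum_distrib_left)
  also have "(\<Sum>a\<in>{1..M}. of_bool (Com a = H)) = real (card {a\<in>{1..M}. Com a = H})"
    by (simp add: Int_def)
  also have "card {a\<in>{1..M}. Com a = H} = community_frequency M Com H * M"
    using M by (simp add: community_frequency_def)
  also have "real (graph_order H) * (community_frequency M Com H * M) / card ?R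
      = real (graph_order H) * community_frequency M Com H
        / (real (card ?R) / M)"
    by simp
  also have "real (card ?R) / M = measure_pmf.expectation (r_degree_pmf M Com) real"
    using M by (simp add: r_degree_pmf_def integral_pmf_of_set card_r_half_edges)
  finally show ?thesis .
qed

text \<open>The weights are nonnegative, and their total is the expectation of \<open>f\<close>
  divided by itself.\<close>

lemma size_biased_pmf_exists:
  fixes f :: "'a \<Rightarrow> real"
  assumes nonneg: "\<And>x. f x \<ge> 0" and int: "integrable (measure_pmf p) f"
    and pos: "measure_pmf.expectation p f > 0"
  obtains q where "\<And>x. pmf q x = f x * pmf p x / measure_pmf.expectation p f"
proof -
  let ?c = "measure_pmf.expectation p f"
  let ?g = "\<lambda>x. f x * pmf p x / ?c"
  have nn: "?g x \<ge> 0" for x using nonneg pos by simp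
  have "(\<integral>\<^sup>+x. ennreal (?g x) \<partial>count_space UNIV)
      = (\<integral>\<^sup>+x. ennreal (pmf p x) * ennreal (f x / ?c) \<partial>count_space UNIV)"
    using nonneg pos by (intro nn_integral_cong) (simp add: ennreal_mult'[symmetric] mult.commute)
  also have "\<dots> = (\<integral>\<^sup>+x. ennreal (f x / ?c) \<partial>measure_pmf p)"
    by (simp add: nn_integral_measure_pmf)
  also have "\<dots> = ennreal (measure_pmf.expectation p (\<lambda>x. f x / ?c))"
    using nonneg pos int by (intro nn_integral_eq_integral) auto
  also have "\<dots> = 1" using pos by simp
  finally have "pmf (embed_pmf ?g) x = ?g x" for x
    using nn by (intro pmf_embed_pmf) auto
  then show thesis by (rule that)
qed

text \<open>In the size-biased weight of \<open>H\<close> the numerator converges by (C) and the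
  denominator by (D). As the limiting denominator is the mean order under \<open>\<mu>\<close>, the
  limiting weights sum to one, so no mass escapes. The kernel \<open>vertex_degree_pmf\<close> does
  not depend on \<open>n\<close>, so mixing preserves the convergence.\<close>

lemma community_degree_converges:
  assumes ord: "\<And>H. H \<in> HH \<Longrightarrow> verts H = {1..graph_order H} \<and> graph_order H > 0"
    and Com: "\<And>n a. a \<in> {1..M n} \<Longrightarrow> Com n a \<in> HH"
    and M: "filterlim M at_top sequentially"
    and \<mu>: "set_pmf \<mu> \<subseteq> HH"
    and C: "\<And>H. H \<in> HH \<Longrightarrow> (\<lambda>n. community_frequency (M n) (Com n) H) \<longlonglongrightarrow> pmf \<mu> H"
    and int: "integrable (measure_pmf (map_pmf graph_order \<mu>)) real"
    and D: "(\<lambda>n. measure_pmf.expectation (r_degree_pmf (M n) (Com n)) real)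
              \<longlonglongrightarrow> measure_pmf.expectation (map_pmf graph_order \<mu>) real"
  obtains p where "pmf_tendsto (\<lambda>n. community_degree_pmf (M n) (Com n)) p"
proof -
  let ?f = "\<lambda>H. real (graph_order H)"
  have ord_pos: "graph_order H > 0" if "H \<in> HH" for H
    using ord[OF that] by blast
  have int': "integrable (measure_pmf \<mu>) ?f"
    using int unfolding map_pmf_rep_eq by (subst (asm) integrable_distr_eq) auto
  \<comment> \<open>Every graph in \<open>HH\<close> has a vertex, so the mean order is at least one
    and may be divided by.\<close>
  have "measure_pmf.expectation \<mu> (\<lambda>_. 1) \<le> measure_pmf.expectation \<mu> ?f"
    using ord_pos \<mu> by (intro integral_mono_AE int') (auto simp: AE_measure_pmf_iff Suc_le_eq)
  then have pos: "measure_pmf.expectation \<mu> ?f > 0" by simp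
  obtain \<nu> where \<nu>: "\<And>H. pmf \<nu> H = ?f H * pmf \<mu> H / measure_pmf.expectation \<mu> ?f"
    using size_biased_pmf_exists[of ?f \<mu>] int' pos by auto
  \<comment> \<open>For small \<open>n\<close> there may be no community at all, so the identities
    for uniform roles hold only eventually.\<close>
  have ev: "\<forall>\<^sub>F n in sequentially. r_half_edges (M n) (Com n) \<noteq> {}"
  proof -
    have "\<forall>\<^sub>F n in sequentially. M n \<ge> 1"
      using M by (simp add: filterlim_at_top)
    then show ?thesis
    proof eventually_elim
      case (elim n)
      then have "(1, 1) \<in> r_half_edges (M n) (Com n)"
        using ord_pos[OF Com[of 1 n]] by (auto simp: r_half_edges_def Suc_le_eq)
      then show ?case by blast
    qed
  qed
  \<comment> \<open>Pointwise convergence is required at every graph; outside \<open>HH\<close> both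
    sides vanish.\<close>
  have freq: "(\<lambda>n. community_frequency (M n) (Com n) H) \<longlonglongrightarrow> pmf \<mu> H" for H
  proof (cases "H \<in> HH")
    case False
    then have "community_frequency (M n) (Com n) H = 0" for n
      using Com by (auto simp: community_frequency_def)
    moreover have "pmf \<mu> H = 0" using False \<mu> by (auto simp: pmf_eq_0_set_pmf)
    ultimately show ?thesis by simp
  qed (rule C)
  have "pmf_tendsto (\<lambda>n. role_community_pmf (M n) (Com n)) \<nu>"
    unfolding pmf_tendsto_def
  proof
    fix H
    have "(\<lambda>n. ?f H * community_frequency (M n) (Com n) H
           / measure_pmf.expectation (r_degree_pmf (M n) (Com n)) real) \<longlonglongrightarrow> pmf \<nu> H"
      unfolding \<nu> using D pos by (intro tendsto_intros freq) auto
    then show "(\<lambda>n. pmf (role_community_pmf (M n) (Com n)) H) \<longlonglongrightarrow> pmf \<nu> H"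
      by (rule Lim_transform_eventually) (use ev in \<open>eventually_elim, simp add: pmf_role_community\<close>)
  qed
  then have lim: "pmf_tendsto (\<lambda>n. bind_pmf (role_community_pmf (M n) (Com n)) vertex_degree_pmf)
      (bind_pmf \<nu> vertex_degree_pmf)"
    by (rule pmf_tendsto_bind) (rule pmf_tendsto_const)
  have "pmf_tendsto (\<lambda>n. community_degree_pmf (M n) (Com n)) (bind_pmf \<nu> vertex_degree_pmf)"
    unfolding pmf_tendsto_def
  proof
    fix d
    have "\<forall>\<^sub>F n in sequentially. pmf (bind_pmf (role_community_pmf (M n) (Com n)) vertex_degree_pmf) d
        = pmf (community_degree_pmf (M n) (Com n)) d"
      using ev
    proof eventually_elim
      case (elim n)
      show ?case
        using ord[OF Com] by (intro arg_cong[where f="\<lambda>p. pmf p d"] sym[OF community_degree_pmf_eq_bind] elim) blast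
    qed
    then show "(\<lambda>n. pmf (community_degree_pmf (M n) (Com n)) d) \<longlonglongrightarrow> pmf (bind_pmf \<nu> vertex_degree_pmf) d"
      by (rule Lim_transform_eventually[OF pmf_tendstoD[OF lim]])
  qed
  then show thesis by (rule that)
qed

section \<open>Uniformly random bijections\<close>

lemma finite_bijections: "finite A \<Longrightarrow> finite B \<Longrightarrow> finite (bijections A B)"
  unfolding bijections_def
  by (rule finite_subset[of _ "A \<rightarrow>\<^sub>E B"]) (auto intro: finite_PiE)

lemma bijections_nonempty:
  assumes "finite A" "finite B" "card A = card B"
  shows "bijections A B \<noteq> {}"
proof -
  obtain f where "bij_betw f A B" using assms finite_same_card_bij by blast
  then have "restrict f A \<in> bijections A B"
    by (auto simp: bijections_def bij_betw_def inj_on_def)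
  then show ?thesis by blast
qed

text \<open>The transposition moves only points of \<open>A\<close>, so the default value outside
  \<open>A\<close> is kept and the composition is again extensional.\<close>

lemma comp_transpose_bijections:
  assumes "\<omega> \<in> bijections A B" "a \<in> A" "e \<in> A"
  shows "\<omega> \<circ> Transposition.transpose a e \<in> bijections A B"
proof -
  have "bij_betw (\<omega> \<circ> Transposition.transpose a e) A B"
    using assms by (simp add: bijections_def bij_betw_swap_iff)
  moreover have "\<omega> \<circ> Transposition.transpose a e \<in> extensional A"
    using assms by (auto simp: bijections_def extensional_def PiE_def Transposition.transpose_def)
  ultimately show ?thesis
    by (auto simp: bijections_def PiE_def bij_betw_def)
qed

text \<open>A finite average in place of an expectation: linearity and monotonicity become facts
  about finite sums, free of integrability conditions.\<close>

definition bijection_mean :: "'a set \<Rightarrow> 'b set \<Rightarrow> (('a \<Rightarrow> 'b) \<Rightarrow> real) \<Rightarrow> real" where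
  "bijection_mean A B f = (\<Sum>\<omega>\<in>bijections A B. f \<omega>) / card (bijections A B)"

lemma bijection_mean_eq_expectation:
  assumes "finite A" "finite B" "card A = card B"
  shows "bijection_mean A B f = measure_pmf.expectation (pmf_of_set (bijections A B)) f"
  using finite_bijections[OF assms(1,2)] bijections_nonempty[OF assms]
  by (simp add: bijection_mean_def integral_pmf_of_set)

lemma bijection_mean_diff:
  "bijection_mean A B (\<lambda>\<omega>. f \<omega> - g \<omega>) = bijection_mean A B f - bijection_mean A B g"
  by (simp add: bijection_mean_def sum_subtractf diff_divide_distrib)

lemma bijection_mean_sum:
  "bijection_mean A B (\<lambda>\<omega>. \<Sum>i\<in>I. f i \<omega>) = (\<Sum>i\<in>I. bijection_mean A B (f i))"
  unfolding bijection_mean_def by (subst sum.swap) (simp add: sum_divide_distrib)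

lemma bijection_mean_cmult: "bijection_mean A B (\<lambda>\<omega>. c * f \<omega>) = c * bijection_mean A B f"
  by (simp add: bijection_mean_def sum_distrib_left)

lemma bijection_mean_cong:
  "(\<And>\<omega>. \<omega> \<in> bijections A B \<Longrightarrow> f \<omega> = g \<omega>) \<Longrightarrow> bijection_mean A B f = bijection_mean A B g"
  by (simp add: bijection_mean_def)

lemma bijection_mean_mono:
  "(\<And>\<omega>. \<omega> \<in> bijections A B \<Longrightarrow> f \<omega> \<le> g \<omega>) \<Longrightarrow> bijection_mean A B f \<le> bijection_mean A B g"
  by (auto simp: bijection_mean_def intro!: divide_right_mono sum_mono)

context
  fixes A :: "'a set" and B :: "'b set"
  assumes finite_A: "finite A" and finite_B: "finite B" and card_eq: "card A = card B"
begin

lemma bijection_mean_const: "bijection_mean A B (\<lambda>_. c) = c"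
  using finite_bijections[OF finite_A finite_B] bijections_nonempty[OF finite_A finite_B card_eq]
  by (simp add: bijection_mean_def card_gt_0_iff)

lemma bijection_mean_unit:
  assumes "\<And>\<omega>. 0 \<le> f \<omega>" "\<And>\<omega>. f \<omega> \<le> 1"
  shows "0 \<le> bijection_mean A B f" "bijection_mean A B f \<le> 1"
  using bijection_mean_mono[of A B "\<lambda>_. 0" f] bijection_mean_mono[of A B f "\<lambda>_. 1"] assms
  by (simp_all add: bijection_mean_const)

text \<open>Precomposing with the transposition of \<open>a\<close> and \<open>e\<close> is an
  involution on the bijections that exchanges the two images and leaves the values on
  \<open>S\<close> alone.\<close>

lemma bijection_mean_transpose:
  assumes dep: "\<And>\<omega> \<omega>' b. (\<And>s. s \<in> S \<Longrightarrow> \<omega> s = \<omega>' s) \<Longrightarrow> \<Psi> \<omega> b = \<Psi> \<omega>' b"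
    and "a \<in> A - S" "e \<in> A - S"
  shows "bijection_mean A B (\<lambda>\<omega>. \<Psi> \<omega> (\<omega> a)) = bijection_mean A B (\<lambda>\<omega>. \<Psi> \<omega> (\<omega> e))"
proof -
  let ?t = "\<lambda>\<omega>. \<omega> \<circ> Transposition.transpose a e"
  have "(\<Sum>\<omega>\<in>bijections A B. \<Psi> \<omega> (\<omega> a)) = (\<Sum>\<omega>\<in>bijections A B. \<Psi> \<omega> (\<omega> e))"
  proof (rule sum.reindex_bij_witness[where i="?t" and j="?t"])
    fix \<omega> assume "\<omega> \<in> bijections A B"
    have "\<Psi> (?t \<omega>) b = \<Psi> \<omega> b" for b
      using assms(2,3) by (intro dep) (auto simp: Transposition.transpose_def)
    then show "\<Psi> (?t \<omega>) (?t \<omega> e) = \<Psi> \<omega> (\<omega> a)" by simp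
  qed (use assms(2,3) in \<open>auto simp: comp_assoc intro: comp_transpose_bijections\<close>)
  then show ?thesis by (simp add: bijection_mean_def)
qed

text \<open>Averaging over the image of \<open>e\<close> amounts to averaging over all of \<open>A\<close>, and by symmetry all
  points outside \<open>S\<close> contribute the same amount as \<open>e\<close>.\<close>

lemma bijection_mean_decouple:
  assumes dep: "\<And>\<omega> \<omega>' b. (\<And>s. s \<in> S \<Longrightarrow> \<omega> s = \<omega>' s) \<Longrightarrow> \<Psi> \<omega> b = \<Psi> \<omega>' b"
    and S: "S \<subseteq> A" and e: "e \<in> A - S"
    and unit: "\<And>\<omega> b. 0 \<le> \<Psi> \<omega> b" "\<And>\<omega> b. \<Psi> \<omega> b \<le> 1"
  shows "\<bar>bijection_mean A B (\<lambda>\<omega>. \<Psi> \<omega> (\<omega> e)) - (\<Sum>b\<in>B. bijection_mean A B (\<lambda>\<omega>. \<Psi> \<omega> b)) / card B\<bar>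
    \<le> card S / card B"
proof -
  let ?E = "bijection_mean A B"
  let ?m = "?E (\<lambda>\<omega>. \<Psi> \<omega> (\<omega> e))"
  have h: "card B > 0" using e finite_A card_eq card_gt_0_iff by fastforce
  have "(\<Sum>b\<in>B. ?E (\<lambda>\<omega>. \<Psi> \<omega> b)) = ?E (\<lambda>\<omega>. \<Sum>b\<in>B. \<Psi> \<omega> b)"
    by (simp add: bijection_mean_sum)
  also have "\<dots> = ?E (\<lambda>\<omega>. \<Sum>a\<in>A. \<Psi> \<omega> (\<omega> a))"
    by (rule bijection_mean_cong) (auto simp: bijections_def sum.reindex_bij_betw)
  also have "\<dots> = (\<Sum>a\<in>A. ?E (\<lambda>\<omega>. \<Psi> \<omega> (\<omega> a)))"
    by (rule bijection_mean_sum)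
  also have "\<dots> = (\<Sum>a\<in>A - S. ?E (\<lambda>\<omega>. \<Psi> \<omega> (\<omega> a))) + (\<Sum>a\<in>S. ?E (\<lambda>\<omega>. \<Psi> \<omega> (\<omega> a)))"
    by (rule sum.subset_diff[OF S finite_A])
  also have "(\<Sum>a\<in>A - S. ?E (\<lambda>\<omega>. \<Psi> \<omega> (\<omega> a))) = (\<Sum>a\<in>A - S. ?m)"
    by (intro sum.cong refl bijection_mean_transpose[where S=S and \<Psi>=\<Psi>, OF dep _ e])
  also have "\<dots> = (\<Sum>a\<in>A. ?m) - (\<Sum>a\<in>S. ?m)"
    using sum.subset_diff[OF S finite_A, of "\<lambda>_. ?m"] by linarith
  finally have "card B * ?m - (\<Sum>b\<in>B. ?E (\<lambda>\<omega>. \<Psi> \<omega> b)) = (\<Sum>a\<in>S. ?m - ?E (\<lambda>\<omega>. \<Psi> \<omega> (\<omega> a)))"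
    by (simp add: card_eq sum_subtractf)
  \<comment> \<open>For points of \<open>S\<close> symmetry fails, but both means lie in the unit
    interval, so each costs at most one.\<close>
  moreover have "\<bar>\<Sum>a\<in>S. ?m - ?E (\<lambda>\<omega>. \<Psi> \<omega> (\<omega> a))\<bar> \<le> (\<Sum>a\<in>S. 1)"
  proof (rule order_trans[OF sum_abs sum_mono])
    fix a
    have "0 \<le> ?E (\<lambda>\<omega>. \<Psi> \<omega> (\<omega> a))" "?E (\<lambda>\<omega>. \<Psi> \<omega> (\<omega> a)) \<le> 1" "0 \<le> ?m" "?m \<le> 1"
      by (intro bijection_mean_unit unit)+
    then show "\<bar>?m - ?E (\<lambda>\<omega>. \<Psi> \<omega> (\<omega> a))\<bar> \<le> 1" by linarith
  qed
  ultimately have "\<bar>card B * ?m - (\<Sum>b\<in>B. ?E (\<lambda>\<omega>. \<Psi> \<omega> b))\<bar> \<le> card S" by simp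
  then have "\<bar>card B * ?m - (\<Sum>b\<in>B. ?E (\<lambda>\<omega>. \<Psi> \<omega> b))\<bar> / card B \<le> card S / card B"
    by (rule divide_right_mono) simp
  moreover have "?m - (\<Sum>b\<in>B. ?E (\<lambda>\<omega>. \<Psi> \<omega> b)) / card B
      = (card B * ?m - (\<Sum>b\<in>B. ?E (\<lambda>\<omega>. \<Psi> \<omega> b))) / card B"
    using h by (simp add: field_simps)
  moreover have "\<bar>(card B * ?m - (\<Sum>b\<in>B. ?E (\<lambda>\<omega>. \<Psi> \<omega> b))) / card B\<bar>
      = \<bar>card B * ?m - (\<Sum>b\<in>B. ?E (\<lambda>\<omega>. \<Psi> \<omega> b))\<bar> / card B"
    by simp
  ultimately show ?thesis by simp
qed

text \<open>Induction on \<open>T\<close>: the new half-edge \<open>e\<close> is decoupled from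
  \<open>S \<union> T\<close>, then the induction hypothesis is applied to \<open>f\<close> shifted
  by \<open>c b\<close> and averaged over \<open>b\<close>; hence \<open>f\<close> is generalised.
  The weight \<open>\<Phi>\<close> carries what depends on half-edges matched earlier, such as those
  of another individual.\<close>

lemma bijection_mean_conv_power:
  fixes c :: "'b \<Rightarrow> nat" and f :: "nat \<Rightarrow> real"
  assumes dep: "\<And>\<omega> \<omega>'. (\<And>s. s \<in> S \<Longrightarrow> \<omega> s = \<omega>' s) \<Longrightarrow> \<Phi> \<omega> = \<Phi> \<omega>'"
    and S: "S \<subseteq> A" and \<Phi>: "\<And>\<omega>. 0 \<le> \<Phi> \<omega>" "\<And>\<omega>. \<Phi> \<omega> \<le> 1"
    and T: "finite T" "T \<subseteq> A - S" and f: "\<And>x. 0 \<le> f x" "\<And>x. f x \<le> 1"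
  shows "\<bar>bijection_mean A B (\<lambda>\<omega>. \<Phi> \<omega> * f (\<Sum>t\<in>T. c (\<omega> t)))
      - bijection_mean A B \<Phi> * measure_pmf.expectation (conv_power (map_pmf c (pmf_of_set B)) (card T)) f\<bar>
    \<le> card T * (card S + card T) / card B"
  using T f
proof (induction T arbitrary: f rule: finite_induct)
  case empty
  then show ?case by (simp add: bijection_mean_def sum_distrib_right)
next
  case (insert e T)
  let ?E = "bijection_mean A B"
  let ?q = "\<lambda>k f. measure_pmf.expectation (conv_power (map_pmf c (pmf_of_set B)) k) (f :: nat \<Rightarrow> real)"
  have e: "e \<in> A - (S \<union> T)" using insert by auto
  have B: "B \<noteq> {}" and h: "card B > 0"
    using e finite_A finite_B card_eq by (auto simp: card_gt_0_iff)
  define \<Psi> where "\<Psi> = (\<lambda>\<omega> b. \<Phi> \<omega> * f (c b + (\<Sum>t\<in>T. c (\<omega> t))))"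
  have "\<bar>?E (\<lambda>\<omega>. \<Psi> \<omega> (\<omega> e)) - (\<Sum>b\<in>B. ?E (\<lambda>\<omega>. \<Psi> \<omega> b)) / card B\<bar> \<le> card (S \<union> T) / card B"
  proof (rule bijection_mean_decouple[OF _ _ e])
    fix \<omega> \<omega>' :: "'a \<Rightarrow> 'b" and b assume *: "\<And>s. s \<in> S \<union> T \<Longrightarrow> \<omega> s = \<omega>' s"
    have "\<Phi> \<omega> = \<Phi> \<omega>'" by (rule dep) (simp add: *)
    moreover have "(\<Sum>t\<in>T. c (\<omega> t)) = (\<Sum>t\<in>T. c (\<omega>' t))" by (simp add: *)
    ultimately show "\<Psi> \<omega> b = \<Psi> \<omega>' b" by (simp add: \<Psi>_def)
  next
    show "S \<union> T \<subseteq> A" using S insert.prems by auto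
  next
    fix \<omega> b
    show "0 \<le> \<Psi> \<omega> b" unfolding \<Psi>_def by (intro mult_nonneg_nonneg \<Phi> insert.prems)
    show "\<Psi> \<omega> b \<le> 1" unfolding \<Psi>_def by (intro mult_le_one \<Phi> insert.prems)
  qed
  moreover have "\<bar>(\<Sum>b\<in>B. ?E (\<lambda>\<omega>. \<Psi> \<omega> b)) / card B - ?E \<Phi> * ?q (card (insert e T)) f\<bar>
      \<le> card T * (card S + card T) / card B"
  proof -
    have "?q (Suc (card T)) f = (\<Sum>b\<in>B. ?q (card T) (\<lambda>y. f (c b + y))) / card B"
      using insert.prems B finite_B abs_of_nonneg
      by (subst expectation_conv_power_Suc[where B=1]) (auto simp: integral_pmf_of_set)
    then have "(\<Sum>b\<in>B. ?E (\<lambda>\<omega>. \<Psi> \<omega> b)) / card B - ?E \<Phi> * ?q (card (insert e T)) f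
        = (\<Sum>b\<in>B. ?E (\<lambda>\<omega>. \<Psi> \<omega> b) - ?E \<Phi> * ?q (card T) (\<lambda>y. f (c b + y))) / card B"
      using insert.hyps by (simp add: sum_subtractf diff_divide_distrib sum_distrib_left)
    also have "\<bar>\<dots>\<bar> \<le> (\<Sum>b\<in>B. card T * (card S + card T) / card B) / card B"
    proof -
      have "\<bar>?E (\<lambda>\<omega>. \<Psi> \<omega> b) - ?E \<Phi> * ?q (card T) (\<lambda>y. f (c b + y))\<bar>
          \<le> card T * (card S + card T) / card B" for b
        unfolding \<Psi>_def using insert.prems by (intro insert.IH) auto
      then show ?thesis
        unfolding abs_divide abs_of_nat
        by (intro divide_right_mono order_trans[OF sum_abs sum_mono]) auto
    qed
    also have "\<dots> = card T * (card S + card T) / card B"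
      using h by simp
    finally show ?thesis .
  qed
  moreover have "?E (\<lambda>\<omega>. \<Phi> \<omega> * f (\<Sum>t\<in>insert e T. c (\<omega> t))) = ?E (\<lambda>\<omega>. \<Psi> \<omega> (\<omega> e))"
    using insert.hyps by (simp add: \<Psi>_def)
  \<comment> \<open>With \<open>s\<close> and \<open>t\<close> the sizes of \<open>S\<close> and
    \<open>T\<close>, the new cost \<open>s + t\<close> and the old \<open>t * (s + t)\<close> fit
    into \<open>(t + 1) * (s + t + 1)\<close>.\<close>
  moreover have "card (S \<union> T) / card B + card T * (card S + card T) / card B
      \<le> card (insert e T) * (card S + card (insert e T)) / card B"
  proof -
    have "card (S \<union> T) + card T * (card S + card T) \<le> Suc (card T) * (card S + Suc (card T))"
      using card_Un_le[of S T] by simp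
    then have "real (card (S \<union> T) + card T * (card S + card T)) / card B
        \<le> real (Suc (card T) * (card S + Suc (card T))) / card B"
      by (intro divide_right_mono) (simp_all only: of_nat_le_iff of_nat_0_le_iff)
    then show ?thesis using insert.hyps by (simp add: add_divide_distrib)
  qed
  ultimately show ?case by linarith
qed

end

section \<open>Degrees in the random intersection graph\<close>

definition role_degree :: "(nat \<Rightarrow> nat ugraph) \<Rightarrow> nat \<times> nat \<Rightarrow> nat" where
  "role_degree Com = (\<lambda>(a, k). graph_degree (Com a) k)"

definition individual_half_edges :: "(nat \<Rightarrow> nat) \<Rightarrow> nat \<Rightarrow> (nat \<times> nat) set" where
  "individual_half_edges dl v = {v} \<times> {1..dl v}"

lemma finite_individual_half_edges: "finite (individual_half_edges dl v)"
  and card_individual_half_edges: "card (individual_half_edges dl v) = dl v"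
  by (simp_all add: individual_half_edges_def)

lemma individual_half_edges_subset:
  "v \<in> {1..N} \<Longrightarrow> individual_half_edges dl v \<subseteq> l_half_edges N dl"
  by (auto simp: individual_half_edges_def l_half_edges_def)

lemma individual_half_edges_disjoint:
  "v \<noteq> w \<Longrightarrow> individual_half_edges dl v \<inter> individual_half_edges dl w = {}"
  by (auto simp: individual_half_edges_def)

lemma graph_degree_eq_sum:
  assumes "finite (edges G)"
  shows "graph_degree G k = (\<Sum>e\<in>edges G. of_bool (k \<in> e))"
  using assms by (simp add: graph_degree_def Int_def)

text \<open>Double counting: summing over vertices before edges turns edge endpoints into role
  degrees, and \<open>\<omega>\<close> carries roles back to half-edges. The two ends of an edge are
  counted separately, so a self-loop contributes twice on both sides.\<close>

lemma deg_rigc_of_matching: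
  assumes simple: "\<And>a. a \<in> {1..M} \<Longrightarrow> simple_finite_graph (Com a)"
    and verts: "\<And>a. a \<in> {1..M} \<Longrightarrow> verts (Com a) = {1..graph_order (Com a)}"
    and \<omega>: "\<omega> \<in> bijections (l_half_edges N dl) (r_half_edges M Com)"
    and v: "v \<in> {1..N}"
  shows "deg (rigc_of_matching N dl M Com \<omega>) v
    = (\<Sum>t\<in>individual_half_edges dl v. role_degree Com (\<omega> t))"
proof -
  let ?L = "l_half_edges N dl" and ?R = "r_half_edges M Com"
  let ?r = "role_holder N dl \<omega>"
  have bij: "bij_betw \<omega> ?L ?R" using \<omega> by (simp add: bijections_def)
  have fin: "finite (verts (Com a))" "finite (edges (Com a))" if "a \<in> {1..M}" for a
  proof -
    show "finite (verts (Com a))" using simple[OF that] by (simp add: simple_finite_graph_def)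
    then show "finite (edges (Com a))"
      using simple[OF that] by (auto simp: simple_finite_graph_def intro: finite_subset[of _ "Pow (verts (Com a))"])
  qed
  have ends: "count (image_mset (\<lambda>k. ?r (a, k)) (mset_set e)) v
      = (\<Sum>k\<in>verts (Com a). of_bool (k \<in> e) * of_bool (?r (a, k) = v))"
    if a: "a \<in> {1..M}" and e: "e \<in> edges (Com a)" for a e
  proof -
    have sub: "e \<subseteq> verts (Com a)" using simple[OF a] e by (simp add: simple_finite_graph_def)
    then have "finite e" using fin[OF a] finite_subset by blast
    then have "count (image_mset (\<lambda>k. ?r (a, k)) (mset_set e)) v = card {k \<in> e. ?r (a, k) = v}"
      by (auto simp: count_image_mset' intro!: arg_cong[where f=card])
    also have "{k \<in> e. ?r (a, k) = v} = {k \<in> verts (Com a). k \<in> e \<and> ?r (a, k) = v}"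
      using sub by auto
    also have "card \<dots> = (\<Sum>k\<in>verts (Com a). of_bool (k \<in> e \<and> ?r (a, k) = v))"
      using fin[OF a] by (simp add: Int_def)
    also have "\<dots> = (\<Sum>k\<in>verts (Com a). of_bool (k \<in> e) * of_bool (?r (a, k) = v))"
      by (simp add: of_bool_conj)
    finally show ?thesis .
  qed
  have "deg (rigc_of_matching N dl M Com \<omega>) v
      = (\<Sum>a\<in>{1..M}. \<Sum>e\<in>edges (Com a). count (image_mset (\<lambda>k. ?r (a, k)) (mset_set e)) v)"
    using fin by (subst sum.Sigma) (auto simp: deg_def rigc_of_matching_def intro: sum.cong)
  also have "\<dots> = (\<Sum>a\<in>{1..M}. \<Sum>e\<in>edges (Com a). \<Sum>k\<in>verts (Com a). of_bool (k \<in> e) * of_bool (?r (a, k) = v))"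
    by (intro sum.cong refl ends)
  also have "\<dots> = (\<Sum>a\<in>{1..M}. \<Sum>k\<in>verts (Com a). \<Sum>e\<in>edges (Com a). of_bool (k \<in> e) * of_bool (?r (a, k) = v))"
    by (intro sum.cong refl sum.swap)
  also have "\<dots> = (\<Sum>a\<in>{1..M}. \<Sum>k\<in>verts (Com a). graph_degree (Com a) k * of_bool (?r (a, k) = v))"
    by (intro sum.cong refl) (simp add: graph_degree_eq_sum fin sum_distrib_right[symmetric])
  also have "\<dots> = (\<Sum>a\<in>{1..M}. \<Sum>k\<in>{1..graph_order (Com a)}. graph_degree (Com a) k * of_bool (?r (a, k) = v))"
    by (intro sum.cong refl verts)
  also have "\<dots> = (\<Sum>j\<in>?R. role_degree Com j * of_bool (?r j = v))"
    unfolding sum_r_half_edges[symmetric] by (intro sum.cong refl) (auto simp: role_degree_def)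
  also have "\<dots> = (\<Sum>t\<in>?L. role_degree Com (\<omega> t) * of_bool (?r (\<omega> t) = v))"
    by (rule sum.reindex_bij_betw[OF bij, symmetric])
  also have "\<dots> = (\<Sum>t\<in>?L. if t \<in> individual_half_edges dl v then role_degree Com (\<omega> t) else 0)"
  proof (rule sum.cong[OF refl])
    fix t assume t: "t \<in> ?L"
    have "?r (\<omega> t) = fst t"
      using bij t by (simp add: role_holder_def the_inv_into_f_f bij_betw_def)
    moreover have "fst t = v \<longleftrightarrow> t \<in> individual_half_edges dl v"
      using t by (auto simp: individual_half_edges_def l_half_edges_def)
    ultimately show "role_degree Com (\<omega> t) * of_bool (?r (\<omega> t) = v)
        = (if t \<in> individual_half_edges dl v then role_degree Com (\<omega> t) else 0)" by simp
  qed
  also have "\<dots> = (\<Sum>t\<in>individual_half_edges dl v. role_degree Com (\<omega> t))"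
    using individual_half_edges_subset[OF v]
    by (subst sum.inter_restrict[symmetric]) (simp_all add: Int_absorb1)
  finally show ?thesis .
qed

section \<open>Second moment of averages over individuals\<close>

context
  fixes N :: nat and dl :: "nat \<Rightarrow> nat" and B :: "'b set" and c :: "'b \<Rightarrow> nat" and f :: "nat \<Rightarrow> real"
  assumes N: "N > 0" and B: "finite B" and card_B: "card B = (\<Sum>v\<in>{1..N}. dl v)"
    and f: "\<And>x. 0 \<le> f x" "\<And>x. f x \<le> 1"
begin

private abbreviation (input) "E \<equiv> bijection_mean (l_half_edges N dl) B"
private abbreviation (input) "X \<equiv> \<lambda>v \<omega>. \<Sum>t\<in>individual_half_edges dl v. c (\<omega> t)"
private abbreviation (input) "Q \<equiv> \<lambda>k. measure_pmf.expectation (conv_power (map_pmf c (pmf_of_set B)) k) f"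

lemma card_half_edges_eq: "card (l_half_edges N dl) = card B"
  by (simp add: card_B card_l_half_edges)

lemma conv_power_expectation_unit: "0 \<le> Q k" "Q k \<le> 1"
proof -
  show "0 \<le> Q k" using f by (intro Bochner_Integration.integral_nonneg) auto
  have "Q k \<le> measure_pmf.expectation (conv_power (map_pmf c (pmf_of_set B)) k) (\<lambda>_. 1)"
    using f by (intro integral_mono) (auto intro!: integrable_pmf_bounded[where B=1] simp: abs_of_nonneg)
  then show "Q k \<le> 1" by simp
qed

text \<open>The product is regrouped so that only the term of \<open>w\<close> is compared with its
  independent version: once weighted by \<open>f (X v \<omega>)\<close>, at cost
  \<open>dl w * (dl v + dl w)\<close>, and once unweighted, at cost \<open>dl w * dl w\<close>, both
  over \<open>card B\<close>. Together they are at most three times the square of \<open>K\<close>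
  over \<open>card B\<close>.\<close>

lemma covariance_bound:
  assumes v: "v \<in> {1..N}" and w: "w \<in> {1..N}" and "v \<noteq> w" and K: "dl v \<le> K" "dl w \<le> K"
  shows "E (\<lambda>\<omega>. (f (X v \<omega>) - Q (dl v)) * (f (X w \<omega>) - Q (dl w))) \<le> 3 * (real K)\<^sup>2 / card B"
proof -
  note decouple = bijection_mean_conv_power[OF finite_half_edges(2) B card_half_edges_eq,
      where c=c and f=f and T="individual_half_edges dl w", OF _ _ _ _ finite_individual_half_edges _ f]
  have sub: "individual_half_edges dl v \<subseteq> l_half_edges N dl" "individual_half_edges dl w \<subseteq> l_half_edges N dl"
    using v w by (auto intro!: individual_half_edges_subset simp del: atLeastAtMost_iff)
  have disj: "individual_half_edges dl w \<subseteq> l_half_edges N dl - individual_half_edges dl v"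
    using sub individual_half_edges_disjoint[OF \<open>v \<noteq> w\<close>, of dl] by blast
  have "\<bar>E (\<lambda>\<omega>. f (X v \<omega>) * f (X w \<omega>)) - E (\<lambda>\<omega>. f (X v \<omega>)) * Q (dl w)\<bar>
      \<le> dl w * (dl v + dl w) / card B"
    using decouple[where S="individual_half_edges dl v" and \<Phi>="\<lambda>\<omega>. f (X v \<omega>)"] sub f disj
    by (simp add: card_individual_half_edges)
  moreover have "\<bar>E (\<lambda>\<omega>. f (X w \<omega>)) - Q (dl w)\<bar> \<le> dl w * dl w / card B"
    using decouple[where S="{}" and \<Phi>="\<lambda>_. 1"] sub
    by (simp add: card_individual_half_edges bijection_mean_const[OF finite_half_edges(2) B card_half_edges_eq])
  moreover have "E (\<lambda>\<omega>. (f (X v \<omega>) - Q (dl v)) * (f (X w \<omega>) - Q (dl w)))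
      = (E (\<lambda>\<omega>. f (X v \<omega>) * f (X w \<omega>)) - E (\<lambda>\<omega>. f (X v \<omega>)) * Q (dl w))
        - Q (dl v) * (E (\<lambda>\<omega>. f (X w \<omega>)) - Q (dl w))"
  proof -
    have "E (\<lambda>\<omega>. (f (X v \<omega>) - Q (dl v)) * (f (X w \<omega>) - Q (dl w)))
        = E (\<lambda>\<omega>. (f (X v \<omega>) * f (X w \<omega>) - Q (dl w) * f (X v \<omega>)) - (Q (dl v) * f (X w \<omega>) - Q (dl v) * Q (dl w)))"
      by (simp add: algebra_simps)
    also have "\<dots> = (E (\<lambda>\<omega>. f (X v \<omega>) * f (X w \<omega>)) - Q (dl w) * E (\<lambda>\<omega>. f (X v \<omega>)))
        - (Q (dl v) * E (\<lambda>\<omega>. f (X w \<omega>)) - Q (dl v) * Q (dl w))"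
      by (simp only: bijection_mean_diff bijection_mean_cmult
          bijection_mean_const[OF finite_half_edges(2) B card_half_edges_eq])
    finally show ?thesis by (simp add: algebra_simps)
  qed
  moreover have "\<bar>Q (dl v) * (E (\<lambda>\<omega>. f (X w \<omega>)) - Q (dl w))\<bar> \<le> \<bar>E (\<lambda>\<omega>. f (X w \<omega>)) - Q (dl w)\<bar>"
    using conv_power_expectation_unit[of "dl v"] by (simp add: abs_mult mult_left_le_one_le)
  moreover have "real (dl w * (dl v + dl w)) / card B + real (dl w * dl w) / card B \<le> 3 * (real K)\<^sup>2 / card B"
  proof -
    have "dl w * (dl v + dl w) + dl w * dl w \<le> K * (K + K) + K * K"
      using K by (intro add_mono mult_mono) auto
    also have "\<dots> = 3 * K\<^sup>2" by (simp add: power2_eq_square)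
    finally have "real (dl w * (dl v + dl w) + dl w * dl w) \<le> real (3 * K\<^sup>2)"
      by (simp only: of_nat_le_iff)
    then have "real (dl w * (dl v + dl w) + dl w * dl w) / card B \<le> real (3 * K\<^sup>2) / card B"
      by (rule divide_right_mono) simp
    then show ?thesis by (simp add: add_divide_distrib)
  qed
  ultimately show ?thesis by linarith
qed

text \<open>The square is expanded over pairs. The diagonal gives \<open>1 / N\<close>, pairs
  containing an individual with more than \<open>K\<close> memberships give the tail term, and the
  remaining pairs are nearly uncorrelated.\<close>

lemma second_moment_bound:
  "E (\<lambda>\<omega>. ((\<Sum>v\<in>{1..N}. f (X v \<omega>)) / N - (\<Sum>v\<in>{1..N}. Q (dl v)) / N)\<^sup>2)
    \<le> 1 / N + 3 * (real K)\<^sup>2 / card B + 2 * (card {v\<in>{1..N}. dl v > K} / N)"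
proof -
  define Y where "Y = (\<lambda>v \<omega>. f (X v \<omega>) - Q (dl v))"
  have absY: "\<bar>Y v \<omega>\<bar> \<le> 1" for v \<omega>
    using f[of "X v \<omega>"] conv_power_expectation_unit[of "dl v"] unfolding Y_def by linarith
  have pair: "E (\<lambda>\<omega>. Y v \<omega> * Y w \<omega>)
      \<le> of_bool (v = w) + 3 * (real K)\<^sup>2 / card B + of_bool (dl v > K) + of_bool (dl w > K)"
    if v: "v \<in> {1..N}" and w: "w \<in> {1..N}" for v w
  proof (cases "v \<noteq> w \<and> dl v \<le> K \<and> dl w \<le> K")
    case True
    then show ?thesis using covariance_bound[of v w K] v w unfolding Y_def by simp
  next
    \<comment> \<open>The product is at most one, and one of the three indicators on the right
      already equals one.\<close>
    case False
    have "Y v \<omega> * Y w \<omega> \<le> 1" for \<omega>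
      using absY[of v \<omega>] absY[of w \<omega>] abs_le_D1[of "Y v \<omega> * Y w \<omega>" 1]
      by (simp add: abs_mult mult_le_one)
    then have "E (\<lambda>\<omega>. Y v \<omega> * Y w \<omega>) \<le> E (\<lambda>_. 1)"
      by (intro bijection_mean_mono)
    also have "\<dots> = 1"
      by (rule bijection_mean_const[OF finite_half_edges(2) B card_half_edges_eq])
    also have "1 \<le> of_bool (v = w) + 3 * (real K)\<^sup>2 / card B + of_bool (dl v > K) + (of_bool (dl w > K) :: real)"
      using False by (auto simp: of_bool_def)
    finally show ?thesis .
  qed
  have sq: "((\<Sum>v\<in>{1..N}. f (X v \<omega>)) / N - (\<Sum>v\<in>{1..N}. Q (dl v)) / N)\<^sup>2
      = (1 / (real N)\<^sup>2) * (\<Sum>v\<in>{1..N}. \<Sum>w\<in>{1..N}. Y v \<omega> * Y w \<omega>)" for \<omega>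
  proof -
    have "(\<Sum>v\<in>{1..N}. f (X v \<omega>)) / N - (\<Sum>v\<in>{1..N}. Q (dl v)) / N = (\<Sum>v\<in>{1..N}. Y v \<omega>) / N"
      by (simp add: Y_def sum_subtractf diff_divide_distrib)
    then show ?thesis
      by (simp add: power_divide power2_eq_square sum_product)
  qed
  have "E (\<lambda>\<omega>. ((\<Sum>v\<in>{1..N}. f (X v \<omega>)) / N - (\<Sum>v\<in>{1..N}. Q (dl v)) / N)\<^sup>2)
      = (1 / (real N)\<^sup>2) * (\<Sum>v\<in>{1..N}. \<Sum>w\<in>{1..N}. E (\<lambda>\<omega>. Y v \<omega> * Y w \<omega>))"
    unfolding sq bijection_mean_cmult by (simp only: bijection_mean_sum)
  also have "\<dots> \<le> (1 / (real N)\<^sup>2) * (\<Sum>v\<in>{1..N}. \<Sum>w\<in>{1..N}.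
      of_bool (v = w) + 3 * (real K)\<^sup>2 / card B + of_bool (dl v > K) + of_bool (dl w > K))"
    by (intro mult_left_mono sum_mono pair) auto
  also have "(\<Sum>v\<in>{1..N}. \<Sum>w\<in>{1..N}.
      of_bool (v = w) + 3 * (real K)\<^sup>2 / card B + of_bool (dl v > K) + (of_bool (dl w > K) :: real))
      = real N + (real N)\<^sup>2 * (3 * (real K)\<^sup>2 / card B) + 2 * (real N * real (card {v\<in>{1..N}. dl v > K}))"
  proof -
    have diag: "(\<Sum>v\<in>{1..N}. \<Sum>w\<in>{1..N}. of_bool (v = w) :: real) = N"
    proof -
      have "(\<Sum>w\<in>{1..N}. of_bool (v = w) :: real) = 1" if "v \<in> {1..N}" for v
        using that by (simp add: of_bool_def)
      then show ?thesis by simp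
    qed
    have tail: "(\<Sum>w\<in>{1..N}. of_bool (dl w > K) :: real) = card {v\<in>{1..N}. dl v > K}"
      by (simp add: Int_def)
    show ?thesis
      unfolding sum.distrib diag tail sum_distrib_left[symmetric] sum_constant
      by (simp add: tail power2_eq_square sum_distrib_left[symmetric] del: sum_of_bool_eq)
  qed
  also have "(1 / (real N)\<^sup>2) * (real N + (real N)\<^sup>2 * (3 * (real K)\<^sup>2 / card B) + 2 * (real N * real (card {v\<in>{1..N}. dl v > K})))
      = 1 / N + 3 * (real K)\<^sup>2 / card B + 2 * (card {v\<in>{1..N}. dl v > K} / N)"
  proof -
    have "(1 / (x\<^sup>2)) * (x + x\<^sup>2 * y + 2 * (x * z)) = 1 / x + y + 2 * (z / x)" if "x > 0" for x y z :: real
      using that by (simp add: field_simps power2_eq_square)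
    then show ?thesis by this (use N in simp)
  qed
  finally show ?thesis .
qed

end

section \<open>Convergence of the empirical degree distribution\<close>

lemma cdf_real_law_unit: "0 \<le> cdf (real_law p) x" "cdf (real_law p) x \<le> 1"
  by (simp_all add: cdf_real_law)

lemma cdf_real_law_mono: "x \<le> y \<Longrightarrow> cdf (real_law p) x \<le> cdf (real_law p) y"
  unfolding cdf_real_law by (rule measure_pmf.finite_measure_mono) auto

lemma cdf_real_law_eq_expectation:
  "cdf (real_law p) x = measure_pmf.expectation p (\<lambda>k. of_bool (real k \<le> x))"
proof -
  have "(\<lambda>k. of_bool (real k \<le> x) :: real) = indicator {k. real k \<le> x}" by (auto simp: indicator_def)
  then show ?thesis by (simp add: cdf_real_law)
qed

lemma cdf_real_law_bind:
  "cdf (real_law (bind_pmf p g)) x = measure_pmf.expectation p (\<lambda>y. cdf (real_law (g y)) x)"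
  unfolding cdf_real_law_eq_expectation by (rule expectation_bind_pmf[where B=1]) simp

text \<open>Up to \<open>K\<close> only integer points matter, since both functions are constant
  between them, and both vanish below zero. Above \<open>K\<close> the functions are at least
  \<open>1 - \<delta>\<close> and \<open>1 - 2 * \<delta>\<close>, hence within
  \<open>2 * \<delta>\<close> of each other.\<close>

lemma cdf_real_law_uniform:
  assumes close: "\<And>m. m \<le> K \<Longrightarrow> \<bar>cdf (real_law p) (real m) - cdf (real_law q) (real m)\<bar> \<le> \<delta>"
    and tail: "cdf (real_law q) (real K) \<ge> 1 - \<delta>"
  shows "\<bar>cdf (real_law p) x - cdf (real_law q) x\<bar> \<le> 2 * \<delta>"
proof -
  have "\<delta> \<ge> 0" using close[of 0] by linarith
  consider "x < 0" | "x \<ge> 0" "nat \<lfloor>x\<rfloor> \<le> K" | "x > real K"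
    by linarith
  then show ?thesis
  proof cases
    case 1
    then have "{k. real k \<le> x} = {}" by auto
    then show ?thesis using \<open>\<delta> \<ge> 0\<close> by (simp add: cdf_real_law)
  next
    case 2
    have "real k \<le> x \<longleftrightarrow> k \<le> nat \<lfloor>x\<rfloor>" for k
      using 2 by (simp add: le_nat_iff le_floor_iff)
    then have "{k. real k \<le> x} = {k. real k \<le> real (nat \<lfloor>x\<rfloor>)}" by simp
    then show ?thesis using close[OF 2(2)] \<open>\<delta> \<ge> 0\<close> unfolding cdf_real_law by simp
  next
    case 3
    then show ?thesis
      using close[of K] tail cdf_real_law_mono[of "real K" x p] cdf_real_law_mono[of "real K" x q]
        cdf_real_law_unit[of p x] cdf_real_law_unit[of q x] \<open>\<delta> \<ge> 0\<close> by linarith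
  qed
qed

lemma empirical_degree_cdf_eq_cdf:
  assumes "finite (mverts G)" "mverts G \<noteq> {}"
  shows "empirical_degree_cdf G = cdf (real_law (map_pmf (deg G) (pmf_of_set (mverts G))))"
  using assms
  by (auto simp: fun_eq_iff empirical_degree_cdf_def cdf_real_law measure_pmf_of_set vimage_def
      intro!: arg_cong[where f=card])

lemma mverts_RIGC:
  assumes "card (l_half_edges N dl) = card (r_half_edges M Com)" and "G \<in> set_pmf (RIGC N dl M Com)"
  shows "mverts G = {1..N}"
  using assms(2) finite_bijections[OF finite_half_edges(2,1)]
    bijections_nonempty[OF finite_half_edges(2,1) assms(1)]
  by (auto simp: RIGC_def rigc_of_matching_def)

text \<open>The second moment bound with the indicator of \<open>{..x}\<close> as \<open>f\<close>.
  The centring is still the random sum at level \<open>n\<close>, not yet its limit.\<close>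

lemma empirical_degree_cdf_second_moment:
  assumes N: "N > 0"
    and dl: "\<And>v. v \<in> {1..N} \<Longrightarrow> dl v \<ge> 1"
    and simple: "\<And>a. a \<in> {1..M} \<Longrightarrow> simple_finite_graph (Com a)"
    and verts: "\<And>a. a \<in> {1..M} \<Longrightarrow> verts (Com a) = {1..graph_order (Com a)}"
    and half_edges: "(\<Sum>v\<in>{1..N}. dl v) = (\<Sum>a\<in>{1..M}. graph_order (Com a))"
  shows "measure_pmf.expectation (RIGC N dl M Com) (\<lambda>G. (empirical_degree_cdf G x
      - cdf (real_law (bind_pmf (l_degree_pmf N dl) (conv_power (community_degree_pmf M Com)))) x)\<^sup>2)
    \<le> (1 + 3 * (real K)\<^sup>2) / N + 2 * measure_pmf.prob (l_degree_pmf N dl) {k. k > K}"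
proof -
  let ?L = "l_half_edges N dl" and ?R = "r_half_edges M Com"
  let ?f = "\<lambda>k::nat. of_bool (real k \<le> x) :: real"
  let ?p = "map_pmf (role_degree Com) (pmf_of_set ?R)"
  let ?Q = "\<lambda>k. measure_pmf.expectation (conv_power ?p k) ?f"
  have card: "card ?L = card ?R"
    by (simp only: card_l_half_edges card_r_half_edges half_edges)
  have p: "community_degree_pmf M Com = ?p"
    by (simp add: community_degree_pmf_def role_degree_def)
  have q: "cdf (real_law (bind_pmf (l_degree_pmf N dl) (conv_power (community_degree_pmf M Com)))) x
      = (\<Sum>v\<in>{1..N}. ?Q (dl v)) / N"
    unfolding p cdf_real_law_bind cdf_real_law_eq_expectation[of "conv_power _ _"] l_degree_pmf_def
    using N by (simp add: integral_pmf_of_set)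
  have emp: "empirical_degree_cdf (rigc_of_matching N dl M Com \<omega>) x
      = (\<Sum>v\<in>{1..N}. ?f (\<Sum>t\<in>individual_half_edges dl v. role_degree Com (\<omega> t))) / N"
    if \<omega>: "\<omega> \<in> bijections ?L ?R" for \<omega>
  proof -
    let ?G = "rigc_of_matching N dl M Com \<omega>"
    have "(\<Sum>v\<in>{1..N}. ?f (\<Sum>t\<in>individual_half_edges dl v. role_degree Com (\<omega> t)))
        = (\<Sum>v\<in>{1..N}. ?f (deg ?G v))"
      using deg_rigc_of_matching[OF simple verts \<omega>] by (intro sum.cong) auto
    also have "\<dots> = card {v\<in>{1..N}. real (deg ?G v) \<le> x}"
      by (simp add: Int_def)
    finally show ?thesis
      by (simp add: empirical_degree_cdf_def rigc_of_matching_def)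
  qed
  have "measure_pmf.expectation (RIGC N dl M Com) (\<lambda>G. (empirical_degree_cdf G x
      - cdf (real_law (bind_pmf (l_degree_pmf N dl) (conv_power (community_degree_pmf M Com)))) x)\<^sup>2)
    = bijection_mean ?L ?R (\<lambda>\<omega>. (empirical_degree_cdf (rigc_of_matching N dl M Com \<omega>) x
      - (\<Sum>v\<in>{1..N}. ?Q (dl v)) / N)\<^sup>2)"
    unfolding q RIGC_def integral_map_pmf
    by (rule bijection_mean_eq_expectation[OF finite_half_edges(2,1) card, symmetric])
  also have "\<dots> = bijection_mean ?L ?R (\<lambda>\<omega>.
      ((\<Sum>v\<in>{1..N}. ?f (\<Sum>t\<in>individual_half_edges dl v. role_degree Com (\<omega> t))) / N
      - (\<Sum>v\<in>{1..N}. ?Q (dl v)) / N)\<^sup>2)"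
    by (rule bijection_mean_cong) (simp only: emp)
  also have "\<dots> \<le> 1 / N + 3 * (real K)\<^sup>2 / card ?R + 2 * (card {v\<in>{1..N}. dl v > K} / N)"
    by (rule second_moment_bound[OF N finite_half_edges(1)])
       (simp_all only: card_r_half_edges half_edges, simp_all)
  \<comment> \<open>Every individual has at least one membership, so there are at least
    \<open>N\<close> half-edges.\<close>
  also have "3 * (real K)\<^sup>2 / card ?R \<le> 3 * (real K)\<^sup>2 / N"
  proof (rule divide_left_mono)
    have "(\<Sum>v\<in>{1..N}. 1) \<le> (\<Sum>v\<in>{1..N}. dl v)" by (intro sum_mono dl)
    then have "N \<le> card ?R" by (simp add: card_r_half_edges half_edges[symmetric] del: One_nat_def)
    then show "real N \<le> real (card ?R)" "0 < real (card ?R) * real N" using N by simp_all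
  qed simp
  also have "card {v\<in>{1..N}. dl v > K} / N = measure_pmf.prob (l_degree_pmf N dl) {k. k > K}"
    using N by (simp add: l_degree_pmf_def measure_pmf_of_set vimage_def Int_def)
  finally show ?thesis by (simp add: add_divide_distrib)
qed

text \<open>Chebyshev's inequality around zero; finite support makes every function
  integrable.\<close>

lemma prob_le_second_moment:
  fixes X :: "'a \<Rightarrow> real"
  assumes "\<epsilon> > 0" and "finite (set_pmf p)"
  shows "measure_pmf.prob p {y. \<bar>X y\<bar> > \<epsilon>} \<le> measure_pmf.expectation p (\<lambda>y. (X y)\<^sup>2) / \<epsilon>\<^sup>2"
proof -
  have "\<epsilon>\<^sup>2 * indicator {y. \<bar>X y\<bar> > \<epsilon>} y \<le> (X y)\<^sup>2" for y
    using assms power_mono[of \<epsilon> "\<bar>X y\<bar>" 2] by (auto simp: indicator_def)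
  then have "measure_pmf.expectation p (\<lambda>y. \<epsilon>\<^sup>2 * indicator {y. \<bar>X y\<bar> > \<epsilon>} y)
      \<le> measure_pmf.expectation p (\<lambda>y. (X y)\<^sup>2)"
    by (intro integral_mono integrable_measure_pmf_finite assms)
  then show ?thesis using assms by (simp add: field_simps)
qed

lemma pmf_tail_small:
  assumes "e > (0::real)"
  obtains K where "measure_pmf.prob p {k::nat. k > K} < e"
proof -
  obtain A where A: "finite A" "(\<Sum>k\<in>A. pmf p k) > 1 - e"
    using pmf_finite_mass[OF assms] by blast
  obtain K where K: "A \<subseteq> {..K}"
    using A(1) finite_nat_iff_bounded_le by blast
  have "1 - e < measure_pmf.prob p A" using A by (simp add: measure_measure_pmf_finite)
  also have "\<dots> \<le> measure_pmf.prob p {..K}" by (rule measure_pmf.finite_measure_mono) (use K in auto)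
  also have "{..K} = UNIV - {k. k > K}" by auto
  also have "measure_pmf.prob p \<dots> = 1 - measure_pmf.prob p {k. k > K}"
    using measure_pmf.prob_compl[of "{k. k > K}" p] by simp
  finally show thesis by (intro that[of K]) simp
qed

section \<open>Passage to the limit along the sequence of models\<close>

context
  fixes N M :: "nat \<Rightarrow> nat" and dl :: "nat \<Rightarrow> nat \<Rightarrow> nat" and Com :: "nat \<Rightarrow> nat \<Rightarrow> nat ugraph"
    and l p :: "nat pmf"
  assumes N_lim: "filterlim N at_top sequentially"
    and dl_pos: "\<And>n v. v \<in> {1..N n} \<Longrightarrow> dl n v \<ge> 1"
    and simple: "\<And>n a. a \<in> {1..M n} \<Longrightarrow> simple_finite_graph (Com n a)"
    and verts: "\<And>n a. a \<in> {1..M n} \<Longrightarrow> verts (Com n a) = {1..graph_order (Com n a)}"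
    and half_edges: "\<And>n. (\<Sum>v\<in>{1..N n}. dl n v) = (\<Sum>a\<in>{1..M n}. graph_order (Com n a))"
    and l: "pmf_tendsto (\<lambda>n. l_degree_pmf (N n) (dl n)) l"
    and p: "pmf_tendsto (\<lambda>n. community_degree_pmf (M n) (Com n)) p"
begin

private abbreviation (input) "\<G> n \<equiv> RIGC (N n) (dl n) (M n) (Com n)"
private abbreviation (input) "F \<equiv> cdf (real_law (bind_pmf l (conv_power p)))"

lemma card_half_edges_match: "card (l_half_edges (N n) (dl n)) = card (r_half_edges (M n) (Com n))"
  by (simp only: card_l_half_edges card_r_half_edges half_edges)

lemma finite_set_pmf_RIGC: "finite (set_pmf (\<G> n))"
  unfolding RIGC_def
  using finite_bijections[OF finite_half_edges(2,1)]
    bijections_nonempty[OF finite_half_edges(2,1) card_half_edges_match]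
  by simp

lemma eventually_individuals: "\<forall>\<^sub>F n in sequentially. N n > 0"
  by (rule eventually_compose_filterlim[OF eventually_gt_at_top N_lim])

text \<open>The distance to \<open>F\<close> is split at the distribution function
  \<open>b n\<close> of the random sum at level \<open>n\<close>. The cutoff \<open>K\<close> is
  chosen from the limit law \<open>l\<close> alone, before \<open>n\<close> grows.\<close>

lemma second_moment_tendsto:
  "(\<lambda>n. measure_pmf.expectation (\<G> n) (\<lambda>G. (empirical_degree_cdf G x - F x)\<^sup>2)) \<longlonglongrightarrow> 0"
proof (rule tendstoI)
  fix e :: real assume "e > 0"
  define b where "b = (\<lambda>n. cdf (real_law (bind_pmf (l_degree_pmf (N n) (dl n))
    (conv_power (community_degree_pmf (M n) (Com n))))) x)"
  \<comment> \<open>The tail enters the final estimate with factor 4 and the other two errors with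
    factor 2, so each contributes less than \<open>e / 4\<close>.\<close>
  obtain K where K: "measure_pmf.prob l {k. k > K} < e / 16"
    using pmf_tail_small[of "e / 16" l] \<open>e > 0\<close> by auto
  have "b \<longlonglongrightarrow> F x"
    unfolding b_def cdf_real_law by (intro prob_tendsto pmf_tendsto_bind l pmf_tendsto_conv_power p)
  then have "(\<lambda>n. (b n - F x)\<^sup>2) \<longlonglongrightarrow> (F x - F x)\<^sup>2"
    by (intro tendsto_intros)
  then have 1: "\<forall>\<^sub>F n in sequentially. (b n - F x)\<^sup>2 < e / 8"
    by (rule order_tendstoD(2)) (use \<open>e > 0\<close> in simp)
  have 2: "\<forall>\<^sub>F n in sequentially. measure_pmf.prob (l_degree_pmf (N n) (dl n)) {k. k > K} < e / 16"
    by (rule order_tendstoD(2)[OF prob_tendsto[OF l] K])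
  have "filterlim (\<lambda>n. real (N n)) at_top sequentially"
    by (rule filterlim_compose[OF filterlim_real_sequentially N_lim])
  then have "(\<lambda>n. (1 + 3 * (real K)\<^sup>2) / real (N n)) \<longlonglongrightarrow> 0"
    by (intro tendsto_divide_0[OF tendsto_const] filterlim_at_top_imp_at_infinity)
  then have 3: "\<forall>\<^sub>F n in sequentially. (1 + 3 * (real K)\<^sup>2) / real (N n) < e / 8"
    by (rule order_tendstoD(2)) (use \<open>e > 0\<close> in simp)
  show "\<forall>\<^sub>F n in sequentially.
      dist (measure_pmf.expectation (\<G> n) (\<lambda>G. (empirical_degree_cdf G x - F x)\<^sup>2)) 0 < e"
    using 1 2 3 eventually_individuals
  proof eventually_elim
    case (elim n)
    note int = integrable_measure_pmf_finite[OF finite_set_pmf_RIGC]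
    have "(empirical_degree_cdf G x - F x)\<^sup>2 \<le> 2 * (empirical_degree_cdf G x - b n)\<^sup>2 + 2 * (b n - F x)\<^sup>2" for G
      using sum_squares_bound[of "empirical_degree_cdf G x - b n" "b n - F x"]
      by (simp add: power2_eq_square algebra_simps)
    then have "measure_pmf.expectation (\<G> n) (\<lambda>G. (empirical_degree_cdf G x - F x)\<^sup>2)
        \<le> measure_pmf.expectation (\<G> n) (\<lambda>G. 2 * (empirical_degree_cdf G x - b n)\<^sup>2 + 2 * (b n - F x)\<^sup>2)"
      by (intro integral_mono int)
    also have "\<dots> = 2 * measure_pmf.expectation (\<G> n) (\<lambda>G. (empirical_degree_cdf G x - b n)\<^sup>2) + 2 * (b n - F x)\<^sup>2"
      by (simp add: int)
    finally have split: "measure_pmf.expectation (\<G> n) (\<lambda>G. (empirical_degree_cdf G x - F x)\<^sup>2)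
        \<le> 2 * measure_pmf.expectation (\<G> n) (\<lambda>G. (empirical_degree_cdf G x - b n)\<^sup>2) + 2 * (b n - F x)\<^sup>2" .
    have "measure_pmf.expectation (\<G> n) (\<lambda>G. (empirical_degree_cdf G x - b n)\<^sup>2)
        \<le> (1 + 3 * (real K)\<^sup>2) / N n + 2 * measure_pmf.prob (l_degree_pmf (N n) (dl n)) {k. k > K}"
      unfolding b_def
      by (rule empirical_degree_cdf_second_moment) (use elim dl_pos simple verts half_edges in blast)+
    with split have "measure_pmf.expectation (\<G> n) (\<lambda>G. (empirical_degree_cdf G x - F x)\<^sup>2) < e"
      using elim \<open>e > 0\<close> by linarith
    moreover have "measure_pmf.expectation (\<G> n) (\<lambda>G. (empirical_degree_cdf G x - F x)\<^sup>2) \<ge> 0"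
      by (rule Bochner_Integration.integral_nonneg) simp
    ultimately show ?case by (simp add: dist_real_def)
  qed
qed

lemma empirical_degree_cdf_eq_cdf_RIGC:
  assumes "N n > 0" "G \<in> set_pmf (\<G> n)"
  shows "empirical_degree_cdf G = cdf (real_law (map_pmf (deg G) (pmf_of_set (mverts G))))"
  using mverts_RIGC[OF card_half_edges_match assms(2)] assms(1)
  by (intro empirical_degree_cdf_eq_cdf) auto

text \<open>Choosing \<open>K\<close> so that the limit has little mass beyond it reduces the
  supremum to the integers up to \<open>K\<close>; a union bound with Chebyshev's inequality at each
  of them finishes.\<close>

lemma uniform_distance_tendsto:
  assumes "\<epsilon> > 0"
  shows "(\<lambda>n. measure_pmf.prob (\<G> n) {G. (SUP x. \<bar>empirical_degree_cdf G x - F x\<bar>) > \<epsilon>}) \<longlonglongrightarrow> 0"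
proof -
  let ?\<delta> = "\<epsilon> / 2"
  obtain K where K: "measure_pmf.prob (bind_pmf l (conv_power p)) {k. k > K} < ?\<delta>"
    using pmf_tail_small[of ?\<delta>] assms by auto
  let ?bound = "\<lambda>n. \<Sum>m\<le>K. measure_pmf.expectation (\<G> n)
    (\<lambda>G. (empirical_degree_cdf G (real m) - F (real m))\<^sup>2) / ?\<delta>\<^sup>2"
  have tail: "F (real K) \<ge> 1 - ?\<delta>"
  proof -
    have "F (real K) = measure_pmf.prob (bind_pmf l (conv_power p)) (UNIV - {k. k > K})"
      by (auto simp: cdf_real_law intro!: arg_cong2[where f=measure])
    also have "\<dots> = 1 - measure_pmf.prob (bind_pmf l (conv_power p)) {k. k > K}"
      using measure_pmf.prob_compl[of "{k. k > K}"] by simp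
    finally show ?thesis using K by simp
  qed
  have "measure_pmf.prob (\<G> n) {G. (SUP x. \<bar>empirical_degree_cdf G x - F x\<bar>) > \<epsilon>} \<le> ?bound n"
    if "N n > 0" for n
  proof -
    let ?B = "\<lambda>m. {G. \<bar>empirical_degree_cdf G (real m) - F (real m)\<bar> > ?\<delta>}"
    \<comment> \<open>Only graphs in the support are considered, because there the vertex set is
      nonempty and finite and the empirical function is a genuine distribution function.\<close>
    have "{G. (SUP x. \<bar>empirical_degree_cdf G x - F x\<bar>) > \<epsilon>} \<inter> set_pmf (\<G> n) \<subseteq> (\<Union>m\<in>{..K}. ?B m)"
    proof (rule subsetI, rule ccontr)
      fix G assume G: "G \<in> {G. (SUP x. \<bar>empirical_degree_cdf G x - F x\<bar>) > \<epsilon>} \<inter> set_pmf (\<G> n)"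
        and nB: "G \<notin> (\<Union>m\<in>{..K}. ?B m)"
      have close: "\<bar>empirical_degree_cdf G (real m) - F (real m)\<bar> \<le> ?\<delta>" if "m \<le> K" for m
      proof -
        have "G \<notin> ?B m" using nB that by blast
        then show ?thesis by (simp only: mem_Collect_eq not_less)
      qed
      have "\<bar>empirical_degree_cdf G x - F x\<bar> \<le> 2 * ?\<delta>" for x
        using close tail unfolding empirical_degree_cdf_eq_cdf_RIGC[OF that IntD2[OF G]]
        by (rule cdf_real_law_uniform)
      then have "(SUP x. \<bar>empirical_degree_cdf G x - F x\<bar>) \<le> 2 * ?\<delta>"
        by (intro cSUP_least) auto
      then show False using G by simp
    qed
    then have "measure_pmf.prob (\<G> n) {G. (SUP x. \<bar>empirical_degree_cdf G x - F x\<bar>) > \<epsilon>}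
        \<le> measure_pmf.prob (\<G> n) (\<Union>m\<in>{..K}. ?B m)"
      by (subst measure_Int_set_pmf[symmetric]) (rule measure_pmf.finite_measure_mono, auto)
    also have "\<dots> \<le> (\<Sum>m\<le>K. measure_pmf.prob (\<G> n) (?B m))"
      by (rule measure_pmf.finite_measure_subadditive_finite) auto
    also have "\<dots> \<le> ?bound n"
      using assms by (intro sum_mono prob_le_second_moment finite_set_pmf_RIGC) simp
    finally show ?thesis .
  qed
  then have le: "\<forall>\<^sub>F n in sequentially.
      measure_pmf.prob (\<G> n) {G. (SUP x. \<bar>empirical_degree_cdf G x - F x\<bar>) > \<epsilon>} \<le> ?bound n"
    using eventually_individuals by (auto elim: eventually_mono)
  have "?bound \<longlonglongrightarrow> (\<Sum>m\<le>K. 0 / ?\<delta>\<^sup>2)"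
    using assms by (intro tendsto_sum tendsto_divide second_moment_tendsto tendsto_const) simp
  then have lim: "?bound \<longlonglongrightarrow> 0" by simp
  show ?thesis
    by (rule tendsto_sandwich[OF _ le tendsto_const lim]) simp
qed

lemma cdf_rigc_degree:
  assumes "N n > 0"
  shows "cdf (real_law (rigc_degree_pmf (N n) (dl n) (M n) (Com n))) x
    = measure_pmf.expectation (\<G> n) (\<lambda>G. empirical_degree_cdf G x)"
  unfolding rigc_degree_pmf_def cdf_real_law_bind
  by (rule integral_cong_AE) (auto simp: AE_measure_pmf_iff empirical_degree_cdf_eq_cdf_RIGC[OF assms])

text \<open>The degree of a uniform individual has the mean of the random empirical function as its
  distribution function, and convergence in mean square implies convergence of means.\<close>

lemma rigc_degree_weak_conv:
  "weak_conv_m (\<lambda>n. real_law (rigc_degree_pmf (N n) (dl n) (M n) (Com n)))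
     (real_law (bind_pmf l (conv_power p)))"
  unfolding weak_conv_m_def weak_conv_def
proof (intro allI impI)
  fix x
  let ?E = "\<lambda>n. measure_pmf.expectation (\<G> n) (\<lambda>G. empirical_degree_cdf G x - F x)"
  \<comment> \<open>Nonnegativity of the variance bounds the squared mean by the second
    moment.\<close>
  have "(?E n)\<^sup>2 \<le> measure_pmf.expectation (\<G> n) (\<lambda>G. (empirical_degree_cdf G x - F x)\<^sup>2)" for n
    using measure_pmf.variance_positive[of "\<G> n" "\<lambda>G. empirical_degree_cdf G x - F x"]
    by (subst (asm) measure_pmf.variance_eq) (auto intro!: integrable_measure_pmf_finite finite_set_pmf_RIGC)
  then have "(\<lambda>n. (?E n)\<^sup>2) \<longlonglongrightarrow> 0"
    by (intro tendsto_sandwich[OF _ _ tendsto_const second_moment_tendsto[of x]]) auto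
  then have "?E \<longlonglongrightarrow> 0" by simp
  then have "(\<lambda>n. ?E n + F x) \<longlonglongrightarrow> 0 + F x" by (intro tendsto_intros)
  moreover have "\<forall>\<^sub>F n in sequentially.
      ?E n + F x = cdf (real_law (rigc_degree_pmf (N n) (dl n) (M n) (Com n))) x"
    using eventually_individuals
  proof eventually_elim
    case (elim n)
    show ?case
      by (simp add: cdf_rigc_degree[OF elim] integrable_measure_pmf_finite[OF finite_set_pmf_RIGC])
  qed
  ultimately show "(\<lambda>n. cdf (real_law (rigc_degree_pmf (N n) (dl n) (M n) (Com n))) x) \<longlonglongrightarrow> F x"
    by (simp add: tendsto_cong)
qed

end

theorem corollary2p9:
  fixes HH :: "nat ugraph set"
    and N M :: "nat \<Rightarrow> nat"
    and dl :: "nat \<Rightarrow> nat \<Rightarrow> nat"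
    and Com :: "nat \<Rightarrow> nat \<Rightarrow> nat ugraph"
    and \<mu> :: "nat ugraph pmf"
    and P :: "'p measure"
    and Dl :: "'p \<Rightarrow> nat"
    and Dc :: "nat \<Rightarrow> 'p \<Rightarrow> real"
    and Dp :: "'p \<Rightarrow> real"
    and Fp :: "real \<Rightarrow> real"
  assumes HH: "community_graph_system HH"
    and N_lim: "filterlim N at_top sequentially"
    and M_lim: "filterlim M at_top sequentially"
    and dl_pos: "\<And>n v. v \<in> {1..N n} \<Longrightarrow> dl n v \<ge> 1"
    and Com_in: "\<And>n a. a \<in> {1..M n} \<Longrightarrow> Com n a \<in> HH"
    and half_edges: "\<And>n. (\<Sum>v\<in>{1..N n}. dl n v) = (\<Sum>a\<in>{1..M n}. graph_order (Com n a))"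
    and P: "prob_space P"
    and A: "weak_conv_m (\<lambda>n. real_law (l_degree_pmf (N n) (dl n)))
              (distr P borel (\<lambda>\<omega>. real (Dl \<omega>)))"
    and B_finite: "integrable P (\<lambda>\<omega>. real (Dl \<omega>))"
    and B: "(\<lambda>n. measure_pmf.expectation (l_degree_pmf (N n) (dl n)) real)
              \<longlonglongrightarrow> (\<integral>\<omega>. real (Dl \<omega>) \<partial>P)"
    and C_supp: "set_pmf \<mu> \<subseteq> HH"
    and C: "\<And>H. H \<in> HH \<Longrightarrow> (\<lambda>n. community_frequency (M n) (Com n) H) \<longlonglongrightarrow> pmf \<mu> H"
    and D_finite: "integrable (measure_pmf (map_pmf graph_order \<mu>)) real"
    and D: "(\<lambda>n. measure_pmf.expectation (r_degree_pmf (M n) (Com n)) real)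
              \<longlonglongrightarrow> measure_pmf.expectation (map_pmf graph_order \<mu>) real"
    and indep: "prob_space.indep_vars P (\<lambda>_. borel)
                  (\<lambda>i. if i = 0 then (\<lambda>\<omega>. real (Dl \<omega>)) else Dc i) (UNIV :: nat set)"
    and Dc_law: "\<And>i. i \<ge> 1 \<Longrightarrow>
                  distr P borel (Dc i) =
                  limit_law (\<lambda>n. real_law (community_degree_pmf (M n) (Com n)))"
    and Dp_def: "Dp = (\<lambda>\<omega>. \<Sum>i=1..Dl \<omega>. Dc i \<omega>)"
    and Fp_def: "Fp = (\<lambda>x. measure P {\<omega> \<in> space P. Dp \<omega> \<le> x})"
  shows "(\<forall>\<epsilon>>0. (\<lambda>n. measure_pmf.prob (RIGC (N n) (dl n) (M n) (Com n))
                   {G. (SUP x. \<bar>empirical_degree_cdf G x - Fp x\<bar>) > \<epsilon>}) \<longlonglongrightarrow> 0) \<and>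
         weak_conv_m (\<lambda>n. real_law (rigc_degree_pmf (N n) (dl n) (M n) (Com n)))
           (distr P borel Dp)"
proof -
  interpret prob_space P by fact
  have graph: "simple_finite_graph H" "verts H = {1..graph_order H} \<and> graph_order H > 0" if "H \<in> HH" for H
  proof -
    have adm: "admissible_graph H" "verts H = {1..graph_order H}"
      using HH that by (auto simp: community_graph_system_def)
    then show "simple_finite_graph H" by (simp add: admissible_graph_def)
    then have "graph_order H > 0"
      using adm(1) by (simp add: admissible_graph_def simple_finite_graph_def card_gt_0_iff)
    with adm(2) show "verts H = {1..graph_order H} \<and> graph_order H > 0" by blast
  qed
  \<comment> \<open>Integrability supplies measurability of the real-valued variable, and the floor
    transfers it to \<open>Dl\<close>.\<close>
  have "(\<lambda>\<omega>. real (Dl \<omega>)) \<in> borel_measurable P"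
    using B_finite by (rule borel_measurable_integrable)
  then have "(\<lambda>\<omega>. nat \<lfloor>real (Dl \<omega>)\<rfloor>) \<in> measurable P (count_space UNIV)"
    by measurable
  then have "Dl \<in> measurable P (count_space UNIV)" by simp
  then obtain l where l: "distr P borel (\<lambda>\<omega>. real (Dl \<omega>)) = real_law l"
      "\<And>k. pmf l k = prob {\<omega> \<in> space P. Dl \<omega> = k}"
    using distr_real_eq_real_law[OF P] by blast
  have l_lim: "pmf_tendsto (\<lambda>n. l_degree_pmf (N n) (dl n)) l"
    using A unfolding l(1) by (rule pmf_tendsto_of_weak_conv)
  obtain p where p: "pmf_tendsto (\<lambda>n. community_degree_pmf (M n) (Com n)) p"
    using community_degree_converges[OF graph(2) Com_in M_lim C_supp C D_finite D] by blast
  \<comment> \<open>\<open>limit_law\<close> is a definite description, so \<open>Dc_law\<close>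
    becomes informative only now that convergence to \<open>p\<close> is established.\<close>
  have "limit_law (\<lambda>n. real_law (community_degree_pmf (M n) (Com n))) = real_law p"
    by (intro limit_law_eqI real_distribution_real_law weak_conv_real_law p)
  then have Dc: "distr P borel (Dc i) = real_law p" if "i \<ge> 1" for i
    using Dc_law[OF that] by simp
  have Dp: "Dp \<in> borel_measurable P" "distr P borel Dp = real_law (bind_pmf l (conv_power p))"
    unfolding Dp_def using distr_random_sum[OF indep l(2) Dc] by blast+
  have Fp: "Fp x = cdf (real_law (bind_pmf l (conv_power p))) x" for x
  proof -
    have "Fp x = measure (distr P borel Dp) {..x}"
      unfolding Fp_def by (simp add: measure_distr[OF Dp(1)] vimage_def Int_def conj_commute)
    then show ?thesis by (simp only: Dp(2) cdf_def)
  qed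
  have verts: "verts (Com n a) = {1..graph_order (Com n a)}" if "a \<in> {1..M n}" for n a
    using graph(2)[OF Com_in[OF that]] by blast
  note model = N_lim dl_pos graph(1)[OF Com_in] verts half_edges l_lim p
  show ?thesis
    unfolding Fp Dp(2)
    by (intro conjI allI impI uniform_distance_tendsto[OF model] rigc_degree_weak_conv[OF model])
qed

end
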